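(* Fix an integer $n\geq 2$ and let $\mathcal{M}_1=M_n(\mathcal{R}_1)$ and $\mathcal{M}_2=M_n(\mathcal{R}_2)$ be the rings of $n\times n$ matrices over the commutative rings $\mathcal{R}_1,\mathcal{R}_2$ described in the context. Then (1) in $\mathrm{ZFC}+\mathrm{CH}$, $\mathcal{M}_1$ is isomorphic to $\mathcal{M}_2$; (2) in $\mathrm{ZFC}+\mathrm{OCA}$, $\mathcal{M}_1$ is not isomorphic to $\mathcal{M}_2$.
   Context: $\mathcal{R}_1=(\mathcal{P}(\mathbb{N})/Fin,\Delta,\cap,\mathbf{1})$, where $\mathcal{P}(\mathbb{N})/Fin$ is the quotient of $\mathcal{P}(\mathbb{N})$ by $A\approx B$ iff the symmetric difference $A\Delta B$ is finite. $\mathcal{R}_2=(\mathcal{P}(\mathbb{T})/I,\Delta,\cap,\mathbf{1})$, where $\mathbb{T}=\{l,r\}^\star$ ordered by prefix, $I=\{B\subseteq\mathbb{T}:B$ has no infinite antichain (infinite set of pairwise prefix-incomparable words)$\}$, and the quotient is by $A\approx_I B$ iff $A\Delta B\in I$. Operations $\Delta$ (ring addition) and $\cap$ (ring multiplication) are defined on representatives, $\mathbf{1}$ is the class of the whole set. $M_n(R)$ carries the usual matrix addition and multiplication. CH is the Continuum Hypothesis; OCA is the Open Coloring Axiom: if $X\subseteq\mathbb{R}$ and $[X]^2=K_0\cup K_1$ with $K_0$ open in $X\times X$, then either some uncountable $Y\subseteq X$ has $[Y]^2\subseteq K_0$, or $X$ is a countable union of sets $H_n$ with $[H_n]^2\subseteq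 K_1$. *)

theory Defs
  imports
    "HOL-Analysis.Analysis"
    "HOL-Library.Equipollence"
    "HOL-Library.Ramsey"
    "HOL-Library.Sublist"
    "HOL-Algebra.QuotRing"
    "Jordan_Normal_Form.Matrix"
begin

section \<open>The ring of sets of naturals modulo finite sets\<close>

definition eq_mod_fin :: "nat set \<Rightarrow> nat set \<Rightarrow> bool" where
  "eq_mod_fin A B \<longleftrightarrow> finite (sym_diff A B)"

lemma eq_mod_fin_mono2:
  assumes "eq_mod_fin A B" "eq_mod_fin C D" "sym_diff E F \<subseteq> sym_diff A B \<union> sym_diff C D"
  shows "eq_mod_fin E F"
  using assms unfolding eq_mod_fin_def by (meson finite_UnI finite_subset)

quotient_type pnat_fin = "nat set" / eq_mod_fin
proof (rule equivpI)
  show "reflp eq_mod_fin" by (simp add: reflp_def eq_mod_fin_def)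
  show "symp eq_mod_fin" by (simp add: symp_def eq_mod_fin_def)
  show "transp eq_mod_fin"
    by (rule transpI, erule (1) eq_mod_fin_mono2) blast
qed

instantiation pnat_fin :: comm_ring_1
begin

lift_definition zero_pnat_fin :: pnat_fin is "{}" .
lift_definition one_pnat_fin :: pnat_fin is "UNIV" .
lift_definition plus_pnat_fin :: "pnat_fin \<Rightarrow> pnat_fin \<Rightarrow> pnat_fin" is "\<lambda>A B. sym_diff A B"
  by (erule (1) eq_mod_fin_mono2) blast
lift_definition times_pnat_fin :: "pnat_fin \<Rightarrow> pnat_fin \<Rightarrow> pnat_fin" is "\<lambda>A B. A \<inter> B"
  by (erule (1) eq_mod_fin_mono2) blast

text \<open>Every element is its own additive inverse, since \<open>x + x = 0\<close>.\<close>
definition uminus_pnat_fin :: "pnat_fin \<Rightarrow> pnat_fin" where "uminus_pnat_fin x = x"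
definition minus_pnat_fin :: "pnat_fin \<Rightarrow> pnat_fin \<Rightarrow> pnat_fin" where "minus_pnat_fin x y = x + y"

instance
proof
  fix a b c :: pnat_fin
  have eqI: "eq_mod_fin A B" if "A = B" for A B
    using that by (simp add: eq_mod_fin_def)
  show "a * b * c = a * (b * c)" by transfer (rule eqI, blast)
  show "a * b = b * a" by transfer (rule eqI, blast)
  show "1 * a = a" by transfer (rule eqI, blast)
  show "a + b + c = a + (b + c)" by transfer (rule eqI, blast)
  show "a + b = b + a" by transfer (rule eqI, blast)
  show "0 + a = a" by transfer (rule eqI, blast)
  show "- a + a = 0" unfolding uminus_pnat_fin_def by transfer (rule eqI, blast)
  show "a - b = a + - b" by (simp add: uminus_pnat_fin_def minus_pnat_fin_def)
  show "(a + b) * c = a * c + b * c" by transfer (rule eqI, blast)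
  show "(0::pnat_fin) \<noteq> 1" by transfer (simp add: eq_mod_fin_def)
qed

end


section \<open>The ring of sets of nodes of the binary tree modulo sets without infinite antichain\<close>

datatype letter = Left | Right

type_synonym node = "letter list"

definition has_inf_antichain :: "node set \<Rightarrow> bool" where
  "has_inf_antichain B \<longleftrightarrow> (\<exists>A \<subseteq> B. infinite A \<and> pairwise parallel A)"

definition no_antichain_ideal :: "node set set" where
  "no_antichain_ideal = {B. \<not> has_inf_antichain B}"

definition eq_mod_antichain :: "node set \<Rightarrow> node set \<Rightarrow> bool" where
  "eq_mod_antichain A B \<longleftrightarrow> sym_diff A B \<in> no_antichain_ideal"

lemma no_antichain_ideal_empty: "{} \<in> no_antichain_ideal"
  by (auto simp: no_antichain_ideal_def has_inf_antichain_def)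

lemma no_antichain_ideal_subset:
  "B \<in> no_antichain_ideal \<Longrightarrow> A \<subseteq> B \<Longrightarrow> A \<in> no_antichain_ideal"
  by (auto simp: no_antichain_ideal_def has_inf_antichain_def)

lemma no_antichain_ideal_Un:
  assumes "B \<in> no_antichain_ideal" "C \<in> no_antichain_ideal"
  shows "B \<union> C \<in> no_antichain_ideal"
proof (rule ccontr)
  assume "B \<union> C \<notin> no_antichain_ideal"
  then obtain A where A: "A \<subseteq> B \<union> C" "infinite A" "pairwise parallel A"
    by (auto simp: no_antichain_ideal_def has_inf_antichain_def)
  have "A = (A \<inter> B) \<union> (A \<inter> C)" using A(1) by blast
  then have "infinite (A \<inter> B) \<or> infinite (A \<inter> C)"
    using A(2) by (metis finite_UnI)
  moreover have "pairwise parallel (A \<inter> B)" "pairwise parallel (A \<inter> C)"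
    using A(3) by (auto intro: pairwise_subset)
  ultimately show False
    using assms unfolding no_antichain_ideal_def has_inf_antichain_def by blast
qed

lemma UNIV_notin_no_antichain_ideal: "UNIV \<notin> no_antichain_ideal"
proof -
  define f where "f k = replicate k Left @ [Right]" for k :: nat
  have nth: "f k ! i = (if i = k then Right else Left)" if "i \<le> k" for i k
    using that by (auto simp: f_def nth_append)
  have *: "\<not> prefix (f i) (f j)" if "i \<noteq> j" for i j
  proof
    assume p: "prefix (f i) (f j)"
    then have "length (f i) \<le> length (f j)" by (rule prefix_length_le)
    then have ij: "i \<le> j" by (simp add: f_def)
    from p obtain zs where "f j = f i @ zs" by (auto simp: prefix_def)
    then have "f j ! i = f i ! i" by (simp add: nth_append f_def)
    then show False using nth[of i j] nth[of i i] ij that by simp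
  qed
  have "inj f" by (rule injI) (metis * prefix_order.order_refl)
  then have "infinite (range f)" by (rule range_inj_infinite)
  moreover have "pairwise parallel (range f)"
    unfolding pairwise_def parallel_def by (metis * imageE)
  ultimately show ?thesis
    unfolding no_antichain_ideal_def has_inf_antichain_def by blast
qed

lemma eq_mod_antichain_mono2:
  assumes "eq_mod_antichain A B" "eq_mod_antichain C D"
    "sym_diff E F \<subseteq> sym_diff A B \<union> sym_diff C D"
  shows "eq_mod_antichain E F"
  using assms unfolding eq_mod_antichain_def
  by (meson no_antichain_ideal_Un no_antichain_ideal_subset)

quotient_type ptree_ac = "node set" / eq_mod_antichain
proof (rule equivpI)
  show "reflp eq_mod_antichain"
    by (simp add: reflp_def eq_mod_antichain_def no_antichain_ideal_empty)
  show "symp eq_mod_antichain" by (simp add: symp_def eq_mod_antichain_def Un_commute)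
  show "transp eq_mod_antichain"
    by (rule transpI, erule (1) eq_mod_antichain_mono2) blast
qed

instantiation ptree_ac :: comm_ring_1
begin

lift_definition zero_ptree_ac :: ptree_ac is "{}" .
lift_definition one_ptree_ac :: ptree_ac is "UNIV" .
lift_definition plus_ptree_ac :: "ptree_ac \<Rightarrow> ptree_ac \<Rightarrow> ptree_ac" is "\<lambda>A B. sym_diff A B"
  by (erule (1) eq_mod_antichain_mono2) blast
lift_definition times_ptree_ac :: "ptree_ac \<Rightarrow> ptree_ac \<Rightarrow> ptree_ac" is "\<lambda>A B. A \<inter> B"
  by (erule (1) eq_mod_antichain_mono2) blast

definition uminus_ptree_ac :: "ptree_ac \<Rightarrow> ptree_ac" where "uminus_ptree_ac x = x"
definition minus_ptree_ac :: "ptree_ac \<Rightarrow> ptree_ac \<Rightarrow> ptree_ac" where "minus_ptree_ac x y = x + y"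

instance
proof
  fix a b c :: ptree_ac
  have eqI: "eq_mod_antichain A B" if "A = B" for A B
    using that by (simp add: eq_mod_antichain_def no_antichain_ideal_empty)
  show "a * b * c = a * (b * c)" by transfer (rule eqI, blast)
  show "a * b = b * a" by transfer (rule eqI, blast)
  show "1 * a = a" by transfer (rule eqI, blast)
  show "a + b + c = a + (b + c)" by transfer (rule eqI, blast)
  show "a + b = b + a" by transfer (rule eqI, blast)
  show "0 + a = a" by transfer (rule eqI, blast)
  show "- a + a = 0" unfolding uminus_ptree_ac_def by transfer (rule eqI, blast)
  show "a - b = a + - b" by (simp add: uminus_ptree_ac_def minus_ptree_ac_def)
  show "(a + b) * c = a * c + b * c" by transfer (rule eqI, blast)
  show "(0::ptree_ac) \<noteq> 1"
    by transfer (simp add: eq_mod_antichain_def UNIV_notin_no_antichain_ideal)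
qed

end


section \<open>The set-theoretic hypotheses\<close>

definition CH :: bool where
  "CH \<longleftrightarrow> (\<forall>X :: real set. uncountable X \<longrightarrow> X \<approx> (UNIV :: real set))"

text \<open>A set \<open>K\<^sub>0\<close> of unordered pairs is identified with the symmetric set of ordered pairs
  \<open>(x, y)\<close> with \<open>{x, y} \<in> K\<^sub>0\<close>, and openness refers to the latter as a subset of \<open>X \<times> X\<close>.\<close>

definition OCA :: bool where
  "OCA \<longleftrightarrow>
    (\<forall>(X :: real set) K\<^sub>0 K\<^sub>1.
      [X]\<^bsup>2\<^esup> = K\<^sub>0 \<union> K\<^sub>1 \<and>
      openin (top_of_set (X \<times> X)) {(x, y). x \<in> X \<and> y \<in> X \<and> {x, y} \<in> K\<^sub>0} \<longrightarrow>
      (\<exists>Y \<subseteq> X. uncountable Y \<and> [Y]\<^bsup>2\<^esup> \<subseteq> K\<^sub>0) \<or>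
      (\<exists>H :: nat \<Rightarrow> real set. X = (\<Union>k. H k) \<and> (\<forall>k. [H k]\<^bsup>2\<^esup> \<subseteq> K\<^sub>1)))"

end

theory Submission
  imports Defs
begin

text \<open>The centre of a matrix ring consists of the scalar matrices, so the matrix rings are isomorphic
  iff the base rings are. Both ideals have the form ``no arbitrarily large finite cliques'' for a
  symmetric relation, and for such an ideal countable systems of requirements on a set can be
  met by adding larger and larger finite cliques. Hence countable partial isomorphisms
  of the quotients extend, and under CH a back-and-forth construction of length \<open>\<omega>\<^sub>1\<close> succeeds.

  Under OCA, look at pairwise incomparable infinite chains \<open>C\<^sub>0, C\<^sub>1, \<dots>\<close> of nodes. A subset of their union is
  small iff it meets finitely many of them. Identify \<open>C\<^sub>n\<close> with \<open>2\<^sup>n \<times> \<nat>\<close>; then every real \<open>x\<close> selects one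
  column in each level, and the subgraphs of functions \<open>p : \<nat> \<rightarrow> \<nat>\<close> inside these columns have images
  \<open>G x p\<close> in \<open>P(\<nat>)\<close> that increase with \<open>p\<close>. An uncountable clique for a suitable open colouring of the
  triples \<open>(x, p, q)\<close>, \<open>p \<le> q\<close>, is impossible, since the union of the subgraphs of the \<open>p\<close>'s separates
  uniformly. So OCA splits the triples into countably many pieces on which \<open>G\<close> is monotone in the pointwise
  sense. For a generic \<open>x\<close> one piece gives functions \<open>p\<^sub>m\<close>, \<open>m\<close> ranging over almost all points
  of the image of the whole column set, with \<open>m \<in> G x p\<^sub>m\<close> and with a common pointwise bound \<open>r\<close>. Then \<open>G x r\<close> contains
  almost all of this image, although the subgraph of \<open>r\<close> misses a point of every level.\<close>

section \<open>Ideals given by finite cliques\<close>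

text \<open>\<open>pairwise\<close> constrains distinct elements only, so for
  \<open>(\<noteq>)\<close> every set is a clique and the small sets are the finite ones. Bigness is
  witnessed by finite sets, so it can be arranged one finite set at a time.\<close>

definition big :: "('a \<Rightarrow> 'a \<Rightarrow> bool) \<Rightarrow> 'a set \<Rightarrow> bool" where
  "big R A \<longleftrightarrow> (\<forall>k. \<exists>F \<subseteq> A. finite F \<and> pairwise R F \<and> k \<le> card F)"

lemma big_mono: "big R A \<Longrightarrow> A \<subseteq> B \<Longrightarrow> big R B"
  unfolding big_def by (meson order_trans)

text \<open>A clique with at least \<open>k + l\<close> elements has \<open>k\<close> of them in
  \<open>A\<close> or \<open>l\<close> of them outside \<open>A\<close>, and subsets of cliques are
  cliques. So the sets that are not big form an ideal.\<close>

lemma big_Un: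
  assumes "big R (A \<union> B)"
  shows "big R A \<or> big R B"
proof (rule ccontr)
  assume "\<not> ?thesis"
  then obtain k l where
    k: "\<And>F. F \<subseteq> A \<Longrightarrow> finite F \<Longrightarrow> pairwise R F \<Longrightarrow> card F < k" and
    l: "\<And>F. F \<subseteq> B \<Longrightarrow> finite F \<Longrightarrow> pairwise R F \<Longrightarrow> card F < l"
    unfolding big_def by (meson not_le)
  obtain F where F: "F \<subseteq> A \<union> B" "finite F" "pairwise R F" "k + l \<le> card F"
    using assms unfolding big_def by blast
  have "card (F \<inter> A) < k"
    by (rule k) (use F in \<open>auto intro: pairwise_subset\<close>)
  moreover have "card (F - A) < l"
    by (rule l) (use F in \<open>auto intro: pairwise_subset\<close>)
  moreover have "card F = card (F \<inter> A) + card (F - A)"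
    using F(2) by (metis card_Int_Diff)
  ultimately show False using F(4) by simp
qed

lemma finite_not_big: "finite A \<Longrightarrow> \<not> big R A"
  unfolding big_def by (meson card_mono not_less_eq_eq order_trans)

lemma not_big_Un: "\<not> big R A \<Longrightarrow> \<not> big R B \<Longrightarrow> \<not> big R (A \<union> B)"
  using big_Un by blast

lemma not_big_UN:
  assumes "finite I" "\<And>i. i \<in> I \<Longrightarrow> \<not> big R (A i)"
  shows "\<not> big R (\<Union>i\<in>I. A i)"
  using assms by (induction) (auto simp: finite_not_big dest: big_Un)

lemma not_big_cover:
  assumes "\<not> big R A" "\<not> big R B" "C \<subseteq> A \<union> B"
  shows "\<not> big R C"
  using assms big_mono big_Un by metis

lemma big_Diff_finite: "big R A \<Longrightarrow> finite F \<Longrightarrow> big R (A - F)"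
  using not_big_cover[of R "A - F" F A] finite_not_big by blast

section \<open>The two ideals as clique ideals\<close>

lemma big_neq_iff: "big (\<noteq>) A \<longleftrightarrow> infinite A"
proof
  assume inf: "infinite A"
  show "big (\<noteq>) A"
    unfolding big_def
  proof
    fix k
    obtain F where "F \<subseteq> A" "finite F" "card F = k"
      using inf infinite_arbitrarily_large by blast
    then show "\<exists>F\<subseteq>A. finite F \<and> pairwise (\<noteq>) F \<and> k \<le> card F"
      by (auto simp: pairwise_def)
  qed
qed (use finite_not_big in blast)

text \<open>Apart from the node itself, every extension of a node extends one of its two children,
  so bigness can be passed on to a child.\<close>

lemma big_parallel_below:
  fixes B :: "node set"
  assumes "big parallel {v \<in> B. prefix w v}"
  shows "\<exists>w'. prefix w w' \<and> length w' = length w + n \<and> big parallel {v \<in> B. prefix w' v}"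
proof (induction n)
  case 0
  then show ?case using assms by auto
next
  case (Suc n)
  then obtain w' where w': "prefix w w'" "length w' = length w + n"
    and big: "big parallel {v \<in> B. prefix w' v}" by blast
  have "{v \<in> B. prefix w' v} \<subseteq>
    {v \<in> B. prefix (w' @ [Left]) v} \<union> ({v \<in> B. prefix (w' @ [Right]) v} \<union> {w'})"
  proof
    fix v assume v: "v \<in> {v \<in> B. prefix w' v}"
    then obtain zs where "v = w' @ zs" by (auto simp: prefix_def)
    with v show "v \<in> {v \<in> B. prefix (w' @ [Left]) v} \<union>
        ({v \<in> B. prefix (w' @ [Right]) v} \<union> {w'})"
      by (cases zs; cases "hd zs") auto
  qed
  from big_mono[OF big this]
  obtain l where "big parallel {v \<in> B. prefix (w' @ [l]) v}"
    by (auto dest!: big_Un simp: finite_not_big simp del: Un_insert_right)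
  with w' show ?case
    by (intro exI[of _ "w' @ [l]"]) (simp add: prefix_prefix)
qed

text \<open>Two parallel elements cannot both be prefixes of one long node \<open>w'\<close>. So one
  of them is split off while \<open>B\<close> stays big beyond \<open>w'\<close>.\<close>

lemma big_parallel_split:
  fixes B :: "node set"
  assumes "big parallel {v \<in> B. prefix w v}"
  shows "\<exists>b w'. b \<in> B \<and> prefix w b \<and> prefix w w' \<and> parallel b w' \<and> big parallel {v \<in> B. prefix w' v}"
proof -
  obtain F where F: "F \<subseteq> {v \<in> B. prefix w v}" "finite F" "pairwise parallel F" "2 \<le> card F"
    using assms unfolding big_def by meson
  then obtain a b where ab: "a \<in> F" "b \<in> F" "a \<noteq> b"
    by (metis card_le_Suc0_iff_eq not_less_eq_eq numeral_2_eq_2)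
  then have par: "parallel a b" using F by (auto simp: pairwise_def)
  \<comment> \<open>This length makes \<open>w'\<close> at least as long as \<open>a\<close> and
    \<open>b\<close>, so whichever is not parallel to \<open>w'\<close> is a prefix of it.\<close>
  obtain w' where w': "prefix w w'" "length w' = length w + (length a + length b)"
    and big: "big parallel {v \<in> B. prefix w' v}"
    using big_parallel_below[OF assms] by blast
  have "parallel a w' \<or> parallel b w'"
  proof (rule ccontr)
    assume "\<not> ?thesis"
    moreover have "prefix u w'" if "\<not> parallel u w'" "length u \<le> length w'" for u
      using that by (metis parallelI prefix_length_prefix prefix_order.refl)
    ultimately have "prefix a w'" "prefix b w'"
      using w' by auto
    then show False using par by (metis parallelE prefix_same_cases)
  qed
  then show ?thesis using ab F w' big by blast
qed

text \<open>From right to left a comb is built. A branch runs through nodes beyond which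
  \<open>B\<close> stays big, and each step picks an element of \<open>B\<close> that extends the
  current node and is parallel to the next one. All later picks extend that next node.\<close>

lemma has_inf_antichain_iff_big: "has_inf_antichain B \<longleftrightarrow> big parallel B"
proof
  assume "has_inf_antichain B"
  then obtain A where A: "A \<subseteq> B" "infinite A" "pairwise parallel A"
    by (auto simp: has_inf_antichain_def)
  show "big parallel B"
    unfolding big_def
  proof
    fix k
    obtain F where "F \<subseteq> A" "finite F" "card F = k"
      using A(2) infinite_arbitrarily_large by blast
    with A show "\<exists>F\<subseteq>B. finite F \<and> pairwise parallel F \<and> k \<le> card F"
      by (meson order_trans pairwise_subset order_refl)
  qed
next
  assume big: "big parallel B"
  \<comment> \<open>A pair consists of the latest tooth of the comb and the branch node
    reached.\<close>
  let ?P = "\<lambda>(b :: node, w). big parallel {v \<in> B. prefix w v}"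
  have "\<exists>f. \<forall>n. ?P (f n) \<and> (fst (f (Suc n)) \<in> B \<and> prefix (snd (f n)) (fst (f (Suc n))) \<and>
      prefix (snd (f n)) (snd (f (Suc n))) \<and> parallel (fst (f (Suc n))) (snd (f (Suc n))))"
  proof (rule dependent_nat_choice)
    show "\<exists>x. ?P x" using big by (auto intro!: exI[of _ "[]"])
  next
    fix x and n :: nat assume "?P x"
    then obtain b w' where "b \<in> B \<and> prefix (snd x) b \<and> prefix (snd x) w' \<and> parallel b w' \<and>
       big parallel {v \<in> B. prefix w' v}"
      using big_parallel_split[of B "snd x"] by (auto simp: case_prod_beta)
    then show "\<exists>y. ?P y \<and> fst y \<in> B \<and> prefix (snd x) (fst y) \<and>
          prefix (snd x) (snd y) \<and> parallel (fst y) (snd y)"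
      by (intro exI[of _ "(b, w')"]) simp
  qed
  then obtain f where f: "\<And>n. fst (f (Suc n)) \<in> B" "\<And>n. prefix (snd (f n)) (fst (f (Suc n)))"
    "\<And>n. prefix (snd (f n)) (snd (f (Suc n)))" "\<And>n. parallel (fst (f (Suc n))) (snd (f (Suc n)))"
    by blast
  define b where "b n = fst (f (Suc n))" for n
  have mono: "prefix (snd (f m)) (snd (f n))" if "m \<le> n" for m n
    using that by (induction rule: dec_induct) (auto intro: f(3) prefix_order.trans)
  have par: "parallel (b m) (b n)" if "m < n" for m n
  proof -
    have "prefix (snd (f (Suc m))) (b n)"
      unfolding b_def using that mono[of "Suc m" n] f(2) prefix_order.trans by (metis Suc_leI)
    then show ?thesis using f(4)[of m] unfolding b_def
      by (metis parallel_append prefixE append_Nil2)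
  qed
  have par': "parallel (b m) (b n)" if "m \<noteq> n" for m n
    using par[of m n] par[of n m] that by (metis linorder_neqE_nat parallel_commute)
  have "inj b" by (rule injI) (metis par' parallelE prefix_order.refl)
  then have "infinite (range b)" by (rule range_inj_infinite)
  moreover have "pairwise parallel (range b)"
    using par' unfolding pairwise_def by (metis imageE)
  moreover have "range b \<subseteq> B" using f(1) by (auto simp: b_def)
  ultimately show "has_inf_antichain B" unfolding has_inf_antichain_def by blast
qed

section \<open>Interpolation modulo a clique ideal\<close>

lemma big_disjoint_pair:
  assumes "big R A"
  shows "\<exists>F G. finite F \<and> finite G \<and> F \<subseteq> A \<and> G \<subseteq> A \<and> F \<inter> G = {} \<and> pairwise R F \<and> pairwise R G
    \<and> k \<le> card F \<and> k \<le> card G"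
proof -
  obtain F where F: "F \<subseteq> A" "finite F" "pairwise R F" "k \<le> card F"
    using assms unfolding big_def by blast
  obtain G where "G \<subseteq> A - F" "finite G" "pairwise R G" "k \<le> card G"
    using big_Diff_finite[OF assms F(2)] unfolding big_def by blast
  with F show ?thesis by (intro exI[of _ F] exI[of _ G]) auto
qed

text \<open>The usual interpolant between the \<open>a i\<close> and the complements of the
  \<open>b i\<close> is changed by finite cliques, put in or taken out to split the
  \<open>c k\<close>. The cliques of stage \<open>t\<close> avoid the first \<open>t\<close> of the
  \<open>a i\<close> and \<open>b i\<close>, so each of these is affected by finitely many finite
  sets only.\<close>

lemma big_separation:
  fixes a b c :: "nat \<Rightarrow> 'a set"
  assumes disj: "\<And>i j. \<not> big R (a i \<inter> b j)"
  obtains X where "\<And>i. \<not> big R (a i - X)" "\<And>i. \<not> big R (b i \<inter> X)"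
    "\<And>k. (\<And>n. big R (c k - (\<Union>i<n. a i \<union> b i))) \<Longrightarrow> big R (c k \<inter> X) \<and> big R (c k - X)"
proof -
  \<comment> \<open>Decoding \<open>t\<close> as a pair makes every \<open>k\<close> recur at
    arbitrarily late stages.\<close>
  define e where "e t = c (fst (prod_decode t)) - (\<Union>i<t. a i \<union> b i)" for t
  \<comment> \<open>\<open>U\<close> is the finite set of points used at earlier stages;
    \<open>F\<close> is to be put into \<open>X\<close> and \<open>G\<close> kept out of it.\<close>
  define good where "good t U F G \<longleftrightarrow> finite F \<and> finite G \<and> F \<inter> G = {} \<and> F \<union> G \<subseteq> e t \<and>
      (F \<union> G) \<inter> U = {} \<and> (big R (e t) \<longrightarrow> pairwise R F \<and> pairwise R G \<and> t \<le> card F \<and> t \<le> card G)"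
    for t U F G
  have "\<exists>F G. finite U \<longrightarrow> good t U F G" for t U
  proof (cases "finite U \<and> big R (e t)")
    case True
    then have "big R (e t - U)" by (simp add: big_Diff_finite)
    from big_disjoint_pair[OF this, of t]
    obtain F G where "finite F" "finite G" "F \<subseteq> e t - U" "G \<subseteq> e t - U" "F \<inter> G = {}"
      "pairwise R F" "pairwise R G" "t \<le> card F" "t \<le> card G" by (elim exE conjE)
    then have "good t U F G" unfolding good_def by auto
    then show ?thesis by blast
  next
    case False
    then have "finite U \<longrightarrow> good t U {} {}" by (simp add: good_def)
    then show ?thesis by blast
  qed
  then have ex: "\<exists>p. good t U (fst p) (snd p)" if "finite U" for t U
    using that by (metis fst_conv snd_conv)
  define F' G' where "F' t U = fst (SOME p. good t U (fst p) (snd p))"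
    and "G' t U = snd (SOME p. good t U (fst p) (snd p))" for t U
  have good: "good t U (F' t U) (G' t U)" if "finite U" for t U
    unfolding F'_def G'_def by (rule someI_ex[OF ex[OF that]])
  define U where "U = rec_nat {} (\<lambda>t U. U \<union> F' t U \<union> G' t U)"
  have U: "U 0 = {}" "U (Suc t) = U t \<union> F' t (U t) \<union> G' t (U t)" for t
    by (simp_all add: U_def)
  have finU: "finite (U t)" for t
  proof (induction t)
    case (Suc t)
    then show ?case using good[OF Suc] by (simp add: U good_def)
  qed (simp add: U)
  define F G where "F t = F' t (U t)" and "G t = G' t (U t)" for t
  have goodFG: "good t (U t) (F t) (G t)" for t
    unfolding F_def G_def by (rule good[OF finU])
  then have fin: "finite (F t)" "finite (G t)" and disjFG: "F t \<inter> G t = {}"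
    and sub: "F t \<subseteq> e t" "G t \<subseteq> e t" and U_disj: "(F t \<union> G t) \<inter> U t = {}" for t
    by (simp_all add: good_def)
  have large: "pairwise R (F t)" "pairwise R (G t)" "t \<le> card (F t)" "t \<le> card (G t)"
    if "big R (e t)" for t
    using goodFG[of t] that by (simp_all add: good_def)
  have mono: "U s \<subseteq> U t" if "s \<le> t" for s t
    using that by (induction rule: dec_induct) (use U in auto)
  have *: "(F t \<union> G t) \<inter> (F s \<union> G s) = {}" if "s < t" for s t
  proof -
    have "F s \<union> G s \<subseteq> U (Suc s)" by (auto simp: U F_def G_def)
    also have "\<dots> \<subseteq> U t" using that by (intro mono) simp
    finally show ?thesis using U_disj[of t] by blast
  qed
  have FG: "F s \<inter> G t = {}" for s t
    using *[of s t] *[of t s] disjFG[of s] by (cases s t rule: linorder_cases) blast+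
  \<comment> \<open>\<open>A\<close> is the interpolant before the changes: it misses only finitely
    many \<open>a i \<inter> b j\<close> of \<open>a i\<close>, and inside \<open>b i\<close> it
    lies in the \<open>a j\<close> with \<open>j \<le> i\<close>.\<close>
  define A where "A = (\<Union>n. a n - (\<Union>j\<le>n. b j))"
  define X where "X = (A - (\<Union>t. G t)) \<union> (\<Union>t. F t)"
  show ?thesis
  proof
    fix i
    have "a i \<inter> (\<Union>t. G t) \<subseteq> (\<Union>t\<le>i. G t)"
    proof safe
      fix v t assume v: "v \<in> a i" "v \<in> G t"
      then have "v \<in> e t" using sub by blast
      then have "\<not> i < t" using v by (auto simp: e_def)
      then show "v \<in> (\<Union>t\<le>i. G t)" using v by auto
    qed
    then have 1: "\<not> big R (a i \<inter> (\<Union>t. G t))"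
      using finite_not_big[of "\<Union>t\<le>i. G t" R] big_mono fin by (metis finite_UN finite_atMost)
    have 2: "\<not> big R (\<Union>j\<le>i. a i \<inter> b j)" by (rule not_big_UN) (auto simp: disj)
    have "a i - X \<subseteq> (\<Union>j\<le>i. a i \<inter> b j) \<union> (a i \<inter> (\<Union>t. G t))"
      by (auto simp: X_def A_def)
    then show "\<not> big R (a i - X)" by (rule not_big_cover[OF 2 1])
  next
    fix i
    have "b i \<inter> (\<Union>t. F t) \<subseteq> (\<Union>t\<le>i. F t)"
    proof safe
      fix v t assume v: "v \<in> b i" "v \<in> F t"
      then have "v \<in> e t" using sub by blast
      then have "\<not> i < t" using v by (auto simp: e_def)
      then show "v \<in> (\<Union>t\<le>i. F t)" using v by auto
    qed
    then have 1: "\<not> big R (b i \<inter> (\<Union>t. F t))"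
      using finite_not_big[of "\<Union>t\<le>i. F t" R] big_mono fin by (metis finite_UN finite_atMost)
    have 2: "\<not> big R (\<Union>j\<le>i. a j \<inter> b i)" by (rule not_big_UN) (auto simp: disj)
    have "b i \<inter> X \<subseteq> (\<Union>j\<le>i. a j \<inter> b i) \<union> (b i \<inter> (\<Union>t. F t))"
    proof
      fix v assume v: "v \<in> b i \<inter> X"
      show "v \<in> (\<Union>j\<le>i. a j \<inter> b i) \<union> (b i \<inter> (\<Union>t. F t))"
      proof (cases "v \<in> (\<Union>t. F t)")
        case False
        then obtain n where n: "v \<in> a n" "\<forall>j\<le>n. v \<notin> b j" using v by (auto simp: X_def A_def)
        then have "n \<le> i" using v by (meson IntD1 nat_le_linear)
        then show ?thesis using n v by auto
      qed (use v in auto)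
    qed
    then show "\<not> big R (b i \<inter> X)" by (rule not_big_cover[OF 2 1])
  next
    fix k
    assume k: "\<And>n. big R (c k - (\<Union>i<n. a i \<union> b i))"
    have ge: "\<exists>t\<ge>l. big R (e t) \<and> e t \<subseteq> c k" for l
    proof (intro exI conjI)
      show "l \<le> prod_encode (k, l)" by (rule le_prod_encode_2)
      show "big R (e (prod_encode (k, l)))" using k by (simp add: e_def)
      show "e (prod_encode (k, l)) \<subseteq> c k" by (auto simp: e_def)
    qed
    have "big R (c k \<inter> X)"
      unfolding big_def
    proof
      fix l
      obtain t where t: "t \<ge> l" "big R (e t)" "e t \<subseteq> c k" using ge by blast
      have "F t \<subseteq> c k \<inter> X" using t(3) sub(1)[of t] unfolding X_def by blast
      then show "\<exists>D\<subseteq>c k \<inter> X. finite D \<and> pairwise R D \<and> l \<le> card D"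
        using large[OF t(2)] t(1) fin[of t] by (intro exI[of _ "F t"]) auto
    qed
    moreover have "big R (c k - X)"
      unfolding big_def
    proof
      fix l
      obtain t where t: "t \<ge> l" "big R (e t)" "e t \<subseteq> c k" using ge by blast
      have "G t \<subseteq> c k - X" using t(3) sub(2)[of t] FG unfolding X_def by blast
      then show "\<exists>D\<subseteq>c k - X. finite D \<and> pairwise R D \<and> l \<le> card D"
        using large[OF t(2)] t(1) fin[of t] by (intro exI[of _ "G t"]) auto
    qed
    ultimately show "big R (c k \<inter> X) \<and> big R (c k - X)" by (rule conjI)
  qed
qed

section \<open>Extending countable partial isomorphisms\<close>

text \<open>This is the Boolean subalgebra of the product of the two power sets generated by
  \<open>H\<close>. Pairs of representatives postpone all questions of well-definedness on
  classes.\<close>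

inductive_set gen :: "('a set \<times> 'b set) set \<Rightarrow> ('a set \<times> 'b set) set" for H where
  base: "p \<in> H \<Longrightarrow> p \<in> gen H"
| top: "(UNIV, UNIV) \<in> gen H"
| compl: "(c, d) \<in> gen H \<Longrightarrow> (- c, - d) \<in> gen H"
| Int: "(c, d) \<in> gen H \<Longrightarrow> (c', d') \<in> gen H \<Longrightarrow> (c \<inter> c', d \<inter> d') \<in> gen H"

lemma gen_mono:
  assumes "H \<subseteq> K"
  shows "gen H \<subseteq> gen K"
proof
  fix p assume "p \<in> gen H"
  then show "p \<in> gen K" by induction (use assms in \<open>auto intro: gen.intros\<close>)
qed

lemma gen_Diff: "(c, d) \<in> gen H \<Longrightarrow> (c', d') \<in> gen H \<Longrightarrow> (c - c', d - d') \<in> gen H"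
  using gen.Int[OF _ gen.compl] by (simp add: Diff_eq)

lemma gen_Un:
  assumes "(c, d) \<in> gen H" "(c', d') \<in> gen H"
  shows "(c \<union> c', d \<union> d') \<in> gen H"
  using gen.compl[OF gen.Int[OF gen.compl[OF assms(1)] gen.compl[OF assms(2)]]] by simp

lemma gen_empty: "({}, {}) \<in> gen H"
  using gen.compl[OF gen.top] by simp

lemma gen_UN:
  fixes n :: nat
  assumes "\<And>i. i < n \<Longrightarrow> (c i, d i) \<in> gen H"
  shows "((\<Union>i<n. c i), (\<Union>i<n. d i)) \<in> gen H"
  using assms
proof (induction n rule: nat_induct)
  case (Suc n)
  then show ?case using gen_Un[of "c n" "d n"] by (simp add: lessThan_Suc)
qed (simp add: gen_empty)

lemma gen_finite:
  assumes "p \<in> gen H"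
  shows "\<exists>K \<subseteq> H. finite K \<and> p \<in> gen K"
  using assms
proof induction
  case (base p)
  then show ?case by (intro exI[of _ "{p}"]) (auto intro: gen.base)
next
  case top
  then show ?case by (intro exI[of _ "{}"]) (auto intro: gen.top)
next
  case (compl c d)
  then show ?case by (meson gen.compl)
next
  case (Int c d c' d')
  then obtain K K' where "K \<subseteq> H" "finite K" "(c, d) \<in> gen K" "K' \<subseteq> H" "finite K'" "(c', d') \<in> gen K'"
    by blast
  then show ?case
    using gen_mono[of K "K \<union> K'"] gen_mono[of K' "K \<union> K'"]
    by (intro exI[of _ "K \<union> K'"]) (auto intro!: gen.Int)
qed

lemma countable_gen:
  assumes "countable H"
  shows "countable (gen H)"
proof -
  define step :: "('a set \<times> 'b set) set \<Rightarrow> ('a set \<times> 'b set) set"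
    where "step K = K \<union> (\<lambda>(c, d). (- c, - d)) ` K
      \<union> (\<lambda>((c, d), (c', d')). (c \<inter> c', d \<inter> d')) ` (K \<times> K)" for K
  define st where "st n = (step ^^ n) (insert (UNIV, UNIV) H)" for n
  have st_Suc: "st (Suc n) = step (st n)" for n by (simp add: st_def)
  have cnt: "countable (st n)" for n
    by (induction n) (use assms in \<open>auto simp: st_def step_def\<close>)
  have mono: "st m \<subseteq> st n" if "m \<le> n" for m n
    using that by (induction rule: dec_induct) (auto simp: st_Suc step_def)
  have "p \<in> (\<Union>n. st n)" if "p \<in> gen H" for p
    using that
  proof induction
    case (base p)
    then have "p \<in> st 0" by (simp add: st_def)
    then show ?case by blast
  next
    case top
    have "(UNIV, UNIV) \<in> st 0" by (simp add: st_def)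
    then show ?case by blast
  next
    case (compl c d)
    then obtain n where "(c, d) \<in> st n" by blast
    then have "(- c, - d) \<in> st (Suc n)" unfolding st_Suc step_def by force
    then show ?case by blast
  next
    case (Int c d c' d')
    then obtain m n where "(c, d) \<in> st m" "(c', d') \<in> st n" by blast
    then have "(c, d) \<in> st (max m n)" "(c', d') \<in> st (max m n)"
      using mono[of m "max m n"] mono[of n "max m n"] by auto
    then have "(c \<inter> c', d \<inter> d') \<in> st (Suc (max m n))" unfolding st_Suc step_def by force
    then show ?case by blast
  qed
  then show ?thesis using cnt by (intro countable_subset[of "gen H" "\<Union>n. st n"]) auto
qed

text \<open>The normal form for adjoining one element to a Boolean algebra reduces questions about
  the larger algebra to traces on \<open>a\<close> and on its complement.\<close>

lemma gen_insertE:
  assumes "p \<in> gen (insert (a, b) H)"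
  obtains c d c' d' where "(c, d) \<in> gen H" "(c', d') \<in> gen H"
    "p = (a \<inter> c \<union> (c' - a), b \<inter> d \<union> (d' - b))"
proof -
  have "\<exists>c d c' d'. (c, d) \<in> gen H \<and> (c', d') \<in> gen H \<and> p = (a \<inter> c \<union> (c' - a), b \<inter> d \<union> (d' - b))"
    using assms
  proof induction
    case (base p)
    then consider "p = (a, b)" | "p \<in> H" by blast
    then show ?case
    proof cases
      case 1
      then show ?thesis using gen.top[of H] gen_empty[of H] by fastforce
    next
      case 2
      obtain c d where p: "p = (c, d)" by (cases p)
      show ?thesis
        by (rule exI[of _ c], rule exI[of _ d], rule exI[of _ c], rule exI[of _ d])
          (use 2 p gen.base in auto)
    qed
  next
    case top
    show ?case
      by (intro exI[of _ UNIV] conjI gen.top) auto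
  next
    case (compl c d)
    then obtain c1 d1 c0 d0 where *: "(c1, d1) \<in> gen H" "(c0, d0) \<in> gen H"
      "(c, d) = (a \<inter> c1 \<union> (c0 - a), b \<inter> d1 \<union> (d0 - b))" by blast
    show ?case
      by (rule exI[of _ "- c1"], rule exI[of _ "- d1"], rule exI[of _ "- c0"], rule exI[of _ "- d0"])
        (use * gen.compl in auto)
  next
    case (Int c d c' d')
    then obtain c1 d1 c0 d0 c1' d1' c0' d0' where *: "(c1, d1) \<in> gen H" "(c0, d0) \<in> gen H"
      "(c, d) = (a \<inter> c1 \<union> (c0 - a), b \<inter> d1 \<union> (d0 - b))"
      "(c1', d1') \<in> gen H" "(c0', d0') \<in> gen H"
      "(c', d') = (a \<inter> c1' \<union> (c0' - a), b \<inter> d1' \<union> (d0' - b))" by blast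
    show ?case
      by (rule exI[of _ "c1 \<inter> c1'"], rule exI[of _ "d1 \<inter> d1'"],
          rule exI[of _ "c0 \<inter> c0'"], rule exI[of _ "d0 \<inter> d0'"])
        (use * gen.Int in auto)
  qed
  then show ?thesis using that by blast
qed

text \<open>As \<open>gen H\<close> is closed under symmetric differences, this says that
  \<open>H\<close> induces an isomorphism between the subalgebras it generates in the two
  quotients.\<close>

definition matched ::
  "('a \<Rightarrow> 'a \<Rightarrow> bool) \<Rightarrow> ('b \<Rightarrow> 'b \<Rightarrow> bool) \<Rightarrow> ('a set \<times> 'b set) set \<Rightarrow> bool" where
  "matched R S H \<longleftrightarrow> (\<forall>(c, d) \<in> gen H. big R c \<longleftrightarrow> big S d)"

lemma matchedD: "matched R S H \<Longrightarrow> (c, d) \<in> gen H \<Longrightarrow> big R c \<longleftrightarrow> big S d"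
  by (auto simp: matched_def)

lemma matched_empty:
  assumes "big R UNIV" "big S UNIV"
  shows "matched R S {}"
proof -
  have "p = (UNIV, UNIV) \<or> p = ({}, {})" if "p \<in> gen {}" for p :: "'a set \<times> 'b set"
    using that by induction auto
  then show ?thesis using assms finite_not_big[of "{}" R] finite_not_big[of "{}" S]
    unfolding matched_def by fastforce
qed

lemma gen_converse: "gen (H\<inverse>) = (gen H)\<inverse>"
proof -
  have *: "(d, c) \<in> gen (K\<inverse>)" if "(c, d) \<in> gen K" for K :: "('x set \<times> 'y set) set" and c d
    using that
    by (induction "(c, d)" arbitrary: c d rule: gen.induct) (auto intro: gen.intros)
  show ?thesis using *[of _ _ H] *[of _ _ "H\<inverse>"] by auto
qed

lemma matched_converse: "matched S R (H\<inverse>) \<longleftrightarrow> matched R S H"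
  unfolding matched_def gen_converse by auto

text \<open>The position of \<open>a\<close> is given by the \<open>c\<close> almost inside it and
  the \<open>c\<close> almost disjoint from it. \<open>big_separation\<close> gives an
  \<open>X\<close> that almost contains the partners of the former, is almost disjoint from those of
  the latter, and splits every partner not almost covered by finitely many of both kinds.\<close>

lemma matched_extend:
  assumes H: "countable H" "matched R S H"
  shows "\<exists>b. matched R S (insert (a, b) H)"
proof -
  define A where "A = {(c, d) \<in> gen H. \<not> big R (c - a)}"
  define B where "B = {(c, d) \<in> gen H. \<not> big R (c \<inter> a)}"
  have cnt: "countable (gen H)" by (rule countable_gen[OF H(1)])
  then have cntAB: "countable A" "countable B" unfolding A_def B_def by (auto elim: countable_subset[rotated])
  have empty: "({}, {}) \<in> A" "({}, {}) \<in> B"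
    by (auto simp: A_def B_def gen_empty finite_not_big)
  define \<alpha> \<beta> \<gamma> where "\<alpha> = from_nat_into A" "\<beta> = from_nat_into B" "\<gamma> = from_nat_into (gen H)"
  then have \<alpha>: "range \<alpha> = A" and \<beta>: "range \<beta> = B" and \<gamma>: "range \<gamma> = gen H"
    using range_from_nat_into[OF _ cntAB(1)] range_from_nat_into[OF _ cntAB(2)]
      range_from_nat_into[OF _ cnt] empty gen_empty[of H] by (metis empty_iff)+
  have "\<alpha> i \<in> A" "\<beta> i \<in> B" "\<gamma> i \<in> gen H" for i
    using rangeI[of \<alpha> i] rangeI[of \<beta> i] rangeI[of \<gamma> i] unfolding \<alpha> \<beta> \<gamma> .
  then have mem: "(fst (\<alpha> i), snd (\<alpha> i)) \<in> gen H" "(fst (\<beta> i), snd (\<beta> i)) \<in> gen H"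
    "(fst (\<gamma> i), snd (\<gamma> i)) \<in> gen H"
    and small: "\<not> big R (fst (\<alpha> i) - a)" "\<not> big R (fst (\<beta> i) \<inter> a)" for i
    unfolding A_def B_def mem_Collect_eq case_prod_beta prod.collapse by blast+
  have "\<not> big S (snd (\<alpha> i) \<inter> snd (\<beta> j))" for i j
  proof -
    have "\<not> big R (fst (\<alpha> i) \<inter> fst (\<beta> j))"
      by (rule not_big_cover[OF small(1)[of i] small(2)[of j]]) auto
    then show ?thesis using matchedD[OF H(2) gen.Int[OF mem(1) mem(2)]] by simp
  qed
  then obtain X where X: "\<And>i. \<not> big S (snd (\<alpha> i) - X)" "\<And>i. \<not> big S (snd (\<beta> i) \<inter> X)"
    "\<And>k. (\<And>n. big S (snd (\<gamma> k) - (\<Union>i<n. snd (\<alpha> i) \<union> snd (\<beta> i)))) \<Longrightarrow>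
      big S (snd (\<gamma> k) \<inter> X) \<and> big S (snd (\<gamma> k) - X)"
    by (rule big_separation[of S "\<lambda>i. snd (\<alpha> i)" "\<lambda>i. snd (\<beta> i)" "\<lambda>i. snd (\<gamma> i)"]) blast
  have le1: "\<not> big S (d \<inter> X)" if "(c, d) \<in> gen H" "\<not> big R (c \<inter> a)" for c d
  proof -
    have "(c, d) \<in> range \<beta>" using that \<beta> by (simp add: B_def)
    then show ?thesis using X(2) by (metis imageE snd_conv)
  qed
  have le2: "\<not> big S (d - X)" if "(c, d) \<in> gen H" "\<not> big R (c - a)" for c d
  proof -
    have "(c, d) \<in> range \<alpha>" using that \<alpha> by (simp add: A_def)
    then show ?thesis using X(1) by (metis imageE snd_conv)
  qed
  \<comment> \<open>If \<open>X\<close> does not split \<open>d\<close>, then \<open>c\<close> is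
    almost covered by finitely many members of \<open>A\<close> and \<open>B\<close>. Their unions
    are \<open>e\<^sub>0\<close>, almost inside \<open>a\<close>, and \<open>e\<^sub>1\<close>,
    almost disjoint from it.\<close>
  have ge: "big S (d \<inter> X) \<and> big S (d - X) \<or>
     (\<exists>e\<^sub>0 f\<^sub>0 e\<^sub>1 f\<^sub>1. (e\<^sub>0, f\<^sub>0) \<in> gen H \<and> (e\<^sub>1, f\<^sub>1) \<in> gen H \<and> \<not> big R (e\<^sub>0 - a) \<and>
       \<not> big R (e\<^sub>1 \<inter> a) \<and> \<not> big R (c - (e\<^sub>0 \<union> e\<^sub>1)))"
    if cd: "(c, d) \<in> gen H" for c d
  proof (cases "\<forall>n. big S (d - (\<Union>i<n. snd (\<alpha> i) \<union> snd (\<beta> i)))")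
    case True
    obtain k where "\<gamma> k = (c, d)" using cd \<gamma> by (metis imageE)
    with True show ?thesis using X(3)[of k] by simp
  next
    case False
    then obtain n where n: "\<not> big S (d - (\<Union>i<n. snd (\<alpha> i) \<union> snd (\<beta> i)))" by blast
    let ?e0 = "\<Union>i<n. fst (\<alpha> i)" and ?f0 = "\<Union>i<n. snd (\<alpha> i)"
    let ?e1 = "\<Union>i<n. fst (\<beta> i)" and ?f1 = "\<Union>i<n. snd (\<beta> i)"
    have 0: "(?e0, ?f0) \<in> gen H" by (rule gen_UN) (rule mem)
    have 1: "(?e1, ?f1) \<in> gen H" by (rule gen_UN) (rule mem)
    have "\<not> big R (\<Union>i<n. fst (\<alpha> i) - a)" by (rule not_big_UN) (auto simp: small)
    then have 2: "\<not> big R (?e0 - a)" by (rule not_big_cover[OF _ finite_not_big[of "{}"]]) auto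
    have "\<not> big R (\<Union>i<n. fst (\<beta> i) \<inter> a)" by (rule not_big_UN) (auto simp: small)
    then have 3: "\<not> big R (?e1 \<inter> a)" by (rule not_big_cover[OF _ finite_not_big[of "{}"]]) auto
    have "\<not> big S (d - (?f0 \<union> ?f1))" using n by (simp add: UN_Un_distrib)
    then have 4: "\<not> big R (c - (?e0 \<union> ?e1))"
      using matchedD[OF H(2) gen_Diff[OF cd gen_Un[OF 0 1]]] by simp
    show ?thesis
      by (intro disjI2 exI conjI) (rule 0 1 2 3 4)+
  qed
  have i: "big R (c \<inter> a) \<longleftrightarrow> big S (d \<inter> X)" if cd: "(c, d) \<in> gen H" for c d
  proof
    assume big: "big R (c \<inter> a)"
    show "big S (d \<inter> X)"
    proof (rule ccontr)
      assume nb: "\<not> big S (d \<inter> X)"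
      then obtain e0 f0 e1 f1 where e: "(e0, f0) \<in> gen H" "(e1, f1) \<in> gen H"
        "\<not> big R (e0 - a)" "\<not> big R (e1 \<inter> a)" "\<not> big R (c - (e0 \<union> e1))"
        using ge[OF cd] by blast
      \<comment> \<open>Since \<open>f0\<close> is almost inside \<open>X\<close>, smallness passes
        from \<open>d \<inter> X\<close> to \<open>d \<inter> f0\<close>, then to
        \<open>c \<inter> e0\<close>, which almost contains \<open>c \<inter> a\<close>.\<close>
      have "\<not> big S ((d \<inter> X) \<union> (f0 - X))"
        using nb le2[OF e(1,3)] by (rule not_big_Un)
      then have "\<not> big S (d \<inter> f0)" using big_mono[of S "d \<inter> f0" "(d \<inter> X) \<union> (f0 - X)"] by blast
      then have "\<not> big R (c \<inter> e0)" using matchedD[OF H(2) gen.Int[OF cd e(1)]] by simp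
      from not_big_Un[OF this not_big_Un[OF e(4,5)]] have "\<not> big R (c \<inter> a)"
        using big_mono[of R "c \<inter> a" "(c \<inter> e0) \<union> ((e1 \<inter> a) \<union> (c - (e0 \<union> e1)))"] by blast
      with big show False by blast
    qed
  qed (use le1[OF cd] in blast)
  have ii: "big R (c - a) \<longleftrightarrow> big S (d - X)" if cd: "(c, d) \<in> gen H" for c d
  proof
    assume big: "big R (c - a)"
    show "big S (d - X)"
    proof (rule ccontr)
      assume nb: "\<not> big S (d - X)"
      then obtain e0 f0 e1 f1 where e: "(e0, f0) \<in> gen H" "(e1, f1) \<in> gen H"
        "\<not> big R (e0 - a)" "\<not> big R (e1 \<inter> a)" "\<not> big R (c - (e0 \<union> e1))"
        using ge[OF cd] by blast
      have "\<not> big S ((d - X) \<union> (f1 \<inter> X))"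
        using nb le1[OF e(2,4)] by (rule not_big_Un)
      then have "\<not> big S (d \<inter> f1)" using big_mono[of S "d \<inter> f1" "(d - X) \<union> (f1 \<inter> X)"] by blast
      then have "\<not> big R (c \<inter> e1)" using matchedD[OF H(2) gen.Int[OF cd e(2)]] by simp
      from not_big_Un[OF this not_big_Un[OF e(3,5)]] have "\<not> big R (c - a)"
        using big_mono[of R "c - a" "(c \<inter> e1) \<union> ((e0 - a) \<union> (c - (e0 \<union> e1)))"] by blast
      with big show False by blast
    qed
  qed (use le2[OF cd] in blast)
  have Un_iff: "big T (C \<union> D) \<longleftrightarrow> big T C \<or> big T D" for T :: "'x \<Rightarrow> 'x \<Rightarrow> bool" and C D
    using big_Un big_mono by (metis Un_upper1 Un_upper2)
  have "matched R S (insert (a, X) H)"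
    unfolding matched_def
  proof clarify
    fix p q assume "(p, q) \<in> gen (insert (a, X) H)"
    then obtain c d c' d' where "(c, d) \<in> gen H" "(c', d') \<in> gen H"
      "(p, q) = (a \<inter> c \<union> (c' - a), X \<inter> d \<union> (d' - X))" by (rule gen_insertE)
    then show "big R p \<longleftrightarrow> big S q"
      using i[of c d] ii[of c' d'] by (simp add: Un_iff Int_commute)
  qed
  then show ?thesis ..
qed

text \<open>One forth and one back step; the back step is a forth step for the converse
  relation.\<close>

lemma matched_extend2:
  assumes "countable H" "matched R S H"
  shows "\<exists>b a'. matched R S (insert (a, b) (insert (a', b') H))"
proof -
  have "H\<inverse> = prod.swap ` H" by force
  then have "countable (H\<inverse>)" using assms(1) by simp
  then obtain a' where "matched S R (insert (b', a') (H\<inverse>))"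
    using matched_extend[of "H\<inverse>" S R b'] assms(2) matched_converse[of S R H] by auto
  moreover have "insert (b', a') (H\<inverse>) = (insert (a', b') H)\<inverse>" by auto
  ultimately have "matched R S (insert (a', b') H)"
    using matched_converse[of S R "insert (a', b') H"] by simp
  then have "\<exists>b. matched R S (insert (a, b) (insert (a', b') H))"
    using matched_extend[of "insert (a', b') H" R S a] assms(1) by simp
  then show ?thesis by blast
qed

section \<open>Back and forth under CH\<close>

text \<open>Either a well-order of \<open>U\<close> has only countable proper initial segments, or
  the segment below the first point with uncountably many predecessors is taken. In both cases the
  order type is omega_1.\<close>

lemma ex_uncountable_countable_segments:
  assumes "uncountable U"
  obtains Z r where "Z \<subseteq> U" "uncountable Z" "wf r" "trans r" "total_on Z r" "r \<subseteq> Z \<times> Z"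
    "\<And>x. countable {y. (y, x) \<in> r}"
proof -
  obtain w where w: "well_order_on U w" using well_order_on by blast
  define s where "s = w - Id"
  have wf: "wf s" using w by (simp add: s_def well_order_on_def)
  have lin: "linear_order_on U w" using w by (simp add: well_order_on_def)
  then have tr: "trans s" unfolding s_def
    by (meson linear_order_on_def partial_order_on_def preorder_on_def trans_diff_Id)
  have tot: "total_on U s" using lin by (auto simp: s_def linear_order_on_def total_on_def)
  have sub: "s \<subseteq> U \<times> U" using well_order_on_domain[OF w] by (auto simp: s_def)
  obtain Z where Z: "Z \<subseteq> U" "uncountable Z" "\<And>x. x \<in> Z \<Longrightarrow> countable {y. (y, x) \<in> s}"
  proof (cases "\<forall>x. countable {y. (y, x) \<in> s}")
    case True
    show ?thesis by (rule that[OF subset_refl assms]) (use True in simp)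
  next
    case False
    then have ne: "{x. uncountable {y. (y, x) \<in> s}} \<noteq> {}" by simp
    obtain x where x: "uncountable {y. (y, x) \<in> s}"
      and min: "\<And>y. (y, x) \<in> s \<Longrightarrow> countable {z. (z, y) \<in> s}"
      by (rule wfE_min'[OF wf ne]) simp
    show ?thesis by (rule that[of "{y. (y, x) \<in> s}"]) (use x min sub in auto)
  qed
  show ?thesis
  proof (rule that[OF Z(1,2), of "s \<inter> Z \<times> Z"])
    show "wf (s \<inter> Z \<times> Z)" using wf by (rule wf_subset) blast
    show "trans (s \<inter> Z \<times> Z)" using tr by (auto simp: trans_def)
    show "total_on Z (s \<inter> Z \<times> Z)" using tot Z(1) by (auto simp: total_on_def)
    show "countable {y. (y, x) \<in> s \<inter> Z \<times> Z}" for x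
    proof (cases "x \<in> Z")
      case True
      show ?thesis by (rule countable_subset[OF _ Z(3)[OF True]]) blast
    next
      case False
      then have "{y. (y, x) \<in> s \<inter> Z \<times> Z} = {}" by blast
      then show ?thesis by (simp only: countable_empty)
    qed
  qed blast
qed

lemma finite_total_bound:
  assumes "finite F" "F \<noteq> {}" "F \<subseteq> Z" "total_on Z r" "trans r"
  shows "\<exists>m\<in>F. \<forall>x\<in>F. x = m \<or> (x, m) \<in> r"
  using assms(1-3)
proof (induction rule: finite_ne_induct)
  case (insert x F)
  then obtain m where m: "m \<in> F" "\<forall>x\<in>F. x = m \<or> (x, m) \<in> r" by blast
  show ?case
  proof (cases "(m, x) \<in> r")
    case True
    then have "\<forall>y\<in>insert x F. y = x \<or> (y, x) \<in> r"
      using m(2) assms(5) by (metis insertE transE)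
    then show ?thesis by blast
  next
    case False
    then have "x = m \<or> (x, m) \<in> r" using assms(4) m(1) insert.prems by (auto simp: total_on_def)
    then show ?thesis using m by blast
  qed
qed auto

text \<open>Each member of \<open>gen H\<close> involves finitely many generators, so being matched
  is a finitary property.\<close>

lemma matched_directed:
  assumes H: "\<And>K. finite K \<Longrightarrow> K \<subseteq> H \<Longrightarrow> \<exists>K'. K \<subseteq> K' \<and> matched R S K'"
  shows "matched R S H"
  unfolding matched_def
proof clarify
  fix c d assume "(c, d) \<in> gen H"
  then obtain K where K: "K \<subseteq> H" "finite K" "(c, d) \<in> gen K" using gen_finite by blast
  then obtain K' where "K \<subseteq> K'" "matched R S K'" using H[OF K(2,1)] by blast
  then show "big R c \<longleftrightarrow> big S d" using K(3) gen_mono[of K K'] matchedD[of R S K' c d] by blast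
qed

lemma matched_total:
  fixes R :: "'a \<Rightarrow> 'a \<Rightarrow> bool" and S :: "'b \<Rightarrow> 'b \<Rightarrow> bool"
    and u :: "'i \<Rightarrow> 'a set" and v :: "'i \<Rightarrow> 'b set"
  assumes big: "big R UNIV" "big S UNIV"
    and r: "wf r" "trans r" "total_on Z r" "r \<subseteq> Z \<times> Z" "\<And>x. countable {y. (y, x) \<in> r}"
    and u: "u ` Z = UNIV" and v: "v ` Z = UNIV"
  shows "\<exists>H. matched R S H \<and> (\<forall>a. \<exists>b. (a, b) \<in> H) \<and> (\<forall>b. \<exists>a. (a, b) \<in> H)"
proof -
  \<comment> \<open>At stage \<open>x\<close>, \<open>fst p\<close> is the partner chosen for
    \<open>u x\<close> and \<open>snd p\<close> the partner chosen for \<open>v x\<close>.\<close>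
  define E where "E x p = {(u x, fst p), (snd p, v x)}" for x and p :: "'b set \<times> 'a set"
  define P where "P f x p = matched R S (E x p \<union> (\<Union>y\<in>{y. (y, x) \<in> r}. E y (f y)))" for f x p
  \<comment> \<open>Finitely many stages are all covered by \<open>P\<close> at the last of them.
    This serves both for the initial segments during the recursion and for the final union.\<close>
  have chain: "matched R S (\<Union>x\<in>Y. E x (f x))"
    if P: "\<And>x. x \<in> Y \<Longrightarrow> P f x (f x)" and Y: "Y \<subseteq> Z" for Y f
  proof (rule matched_directed)
    fix K assume K: "finite K" "K \<subseteq> (\<Union>x\<in>Y. E x (f x))"
    show "\<exists>K'. K \<subseteq> K' \<and> matched R S K'"
    proof (cases "K = {}")
      case True
      then show ?thesis using matched_empty[OF big] by blast
    next
      case False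
      obtain F where F: "F \<subseteq> Y" "finite F" "K \<subseteq> (\<Union>x\<in>F. E x (f x))"
      proof -
        from finite_subset_Union[OF K] obtain \<F>
          where \<F>: "finite \<F>" "\<F> \<subseteq> (\<lambda>x. E x (f x)) ` Y" "K \<subseteq> \<Union> \<F>" .
        from finite_subset_image[OF \<F>(1,2)] obtain F
          where "F \<subseteq> Y" "finite F" "\<F> = (\<lambda>x. E x (f x)) ` F" by blast
        with \<F>(3) show ?thesis using that[of F] by simp
      qed
      have "F \<noteq> {}" using F(3) False by auto
      from finite_total_bound[OF F(2) this subset_trans[OF F(1) Y] r(3,2)]
      obtain m where m: "m \<in> F" "\<forall>x\<in>F. x = m \<or> (x, m) \<in> r" by (rule bexE)
      have "K \<subseteq> E m (f m) \<union> (\<Union>y\<in>{y. (y, m) \<in> r}. E y (f y))"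
      proof
        fix k assume "k \<in> K"
        then obtain x where "x \<in> F" "k \<in> E x (f x)" using F(3) by blast
        then show "k \<in> E m (f m) \<union> (\<Union>y\<in>{y. (y, m) \<in> r}. E y (f y))"
          using m(2) by auto
      qed
      moreover have "matched R S (E m (f m) \<union> (\<Union>y\<in>{y. (y, m) \<in> r}. E y (f y)))"
        using P[of m] m(1) F(1) by (auto simp: P_def)
      ultimately show ?thesis by blast
    qed
  qed
  have "\<exists>f. \<forall>x. P f x (f x)"
  proof (rule dependent_wf_choice[OF r(1)])
    fix f g :: "'i \<Rightarrow> 'b set \<times> 'a set" and x p
    assume eq: "\<And>z. (z, x) \<in> r \<Longrightarrow> f z = g z"
    have "(\<Union>y\<in>{y. (y, x) \<in> r}. E y (f y)) = (\<Union>y\<in>{y. (y, x) \<in> r}. E y (g y))"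
      by (rule SUP_cong) (auto simp: eq)
    then show "P f x p = P g x p" by (simp add: P_def)
  next
    fix x and f :: "'i \<Rightarrow> 'b set \<times> 'a set"
    assume IH: "\<And>y. (y, x) \<in> r \<Longrightarrow> P f y (f y)"
    let ?H = "\<Union>y\<in>{y. (y, x) \<in> r}. E y (f y)"
    have "matched R S ?H" by (rule chain) (use IH r(4) in auto)
    moreover have "countable ?H" using r(5) by (auto simp: E_def)
    ultimately obtain b a where "matched R S (insert (u x, b) (insert (a, v x) ?H))"
      using matched_extend2 by blast
    then have "P f x (b, a)" by (simp add: P_def E_def)
    then show "\<exists>p. P f x p" by blast
  qed
  then obtain f where f: "\<And>x. P f x (f x)" by blast
  show ?thesis
  proof (rule exI, intro conjI allI)
    show "matched R S (\<Union>x\<in>Z. E x (f x))" by (rule chain) (use f in auto)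
    fix a
    obtain x where "x \<in> Z" "a = u x" using u by (metis UNIV_I imageE)
    then show "\<exists>b. (a, b) \<in> (\<Union>x\<in>Z. E x (f x))" by (auto simp: E_def)
  next
    fix b
    obtain x where "x \<in> Z" "b = v x" using v by (metis UNIV_I imageE)
    then show "\<exists>a. (a, b) \<in> (\<Union>x\<in>Z. E x (f x))" by (auto simp: E_def)
  qed
qed

section \<open>From matched families to the quotient rings\<close>

lemma abs_pnat_fin_eq_iff: "abs_pnat_fin A = abs_pnat_fin B \<longleftrightarrow> \<not> big (\<noteq>) (sym_diff A B)"
  by (simp add: pnat_fin.abs_eq_iff eq_mod_fin_def big_neq_iff)

lemma abs_ptree_ac_eq_iff: "abs_ptree_ac A = abs_ptree_ac B \<longleftrightarrow> \<not> big parallel (sym_diff A B)"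
  by (simp add: ptree_ac.abs_eq_iff eq_mod_antichain_def no_antichain_ideal_def has_inf_antichain_iff_big)

lemma ex_pnat_fin: "\<exists>A. x = abs_pnat_fin A"
  by (metis Quotient_abs_rep Quotient_pnat_fin)

lemma ex_ptree_ac: "\<exists>A. x = abs_ptree_ac A"
  by (metis Quotient_abs_rep Quotient_ptree_ac)

instance letter :: countable
  by countable_datatype

lemma CH_imp_ring_bijection:
  assumes CH
  obtains F :: "pnat_fin \<Rightarrow> ptree_ac" where "bij F" "F 1 = 1"
    "\<And>x y. F (x + y) = F x + F y" "\<And>x y. F (x * y) = F x * F y"
proof -
  obtain Z :: "real set" and r where Z: "uncountable Z" and r: "wf r" "trans r" "total_on Z r"
    "r \<subseteq> Z \<times> Z" "\<And>x. countable {y. (y, x) \<in> r}"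
    using ex_uncountable_countable_segments[OF uncountable_UNIV_real] by metis
  have "Z \<approx> (UNIV :: real set)" using assms Z unfolding CH_def by blast
  also have "(UNIV :: real set) \<approx> (UNIV :: nat set set)"
    by (rule eqpoll_sym[OF nat_sets_eqpoll_reals])
  finally obtain u :: "real \<Rightarrow> nat set" where u: "u ` Z = UNIV"
    unfolding eqpoll_def bij_betw_def by blast
  \<comment> \<open>Coding nodes by naturals lets the same index set list all sets of nodes.\<close>
  define v :: "real \<Rightarrow> node set" where "v x = from_nat ` u x" for x
  have v: "v ` Z = UNIV"
  proof (intro equalityI subsetI UNIV_I)
    fix B :: "node set"
    obtain x where "x \<in> Z" "u x = to_nat ` B" using u by (metis UNIV_I imageE)
    then have "v x = B" by (simp add: v_def image_image)
    then show "B \<in> v ` Z" using \<open>x \<in> Z\<close> by blast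
  qed
  have big_nat: "big (\<noteq>) (UNIV :: nat set)" by (simp add: big_neq_iff)
  have big_node: "big parallel (UNIV :: node set)"
    using UNIV_notin_no_antichain_ideal
    by (simp add: no_antichain_ideal_def has_inf_antichain_iff_big)
  obtain H :: "(nat set \<times> node set) set" where H: "matched (\<noteq>) parallel H"
    and total: "\<And>a. \<exists>b. (a, b) \<in> H" "\<And>b. \<exists>a. (a, b) \<in> H"
    using matched_total[OF big_nat big_node r u v] by blast
  have sym: "(sym_diff a a', sym_diff b b') \<in> gen H" if "(a, b) \<in> gen H" "(a', b') \<in> gen H" for a b a' b'
    using that by (intro gen_Un gen_Diff)
  have eq: "abs_pnat_fin a = abs_pnat_fin a' \<longleftrightarrow> abs_ptree_ac b = abs_ptree_ac b'"
    if "(a, b) \<in> gen H" "(a', b') \<in> gen H" for a b a' b'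
    unfolding abs_pnat_fin_eq_iff abs_ptree_ac_eq_iff
    using matchedD[OF H sym[OF that]] by blast
  define F where "F x = abs_ptree_ac (SOME b. (rep_pnat_fin x, b) \<in> H)" for x
  \<comment> \<open>By \<open>eq\<close> every pair in \<open>gen H\<close> computes
    \<open>F\<close>, whichever representative was chosen. Hence sums and products can be compared
    on pairs of \<open>gen H\<close>.\<close>
  have F: "F (abs_pnat_fin a) = abs_ptree_ac b" if "(a, b) \<in> gen H" for a b
  proof -
    have "(rep_pnat_fin (abs_pnat_fin a), SOME b. (rep_pnat_fin (abs_pnat_fin a), b) \<in> H) \<in> gen H"
      by (rule gen.base) (rule someI_ex[OF total(1)])
    moreover have "abs_pnat_fin (rep_pnat_fin (abs_pnat_fin a)) = abs_pnat_fin a"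
      by (rule Quotient_abs_rep[OF Quotient_pnat_fin])
    ultimately show ?thesis unfolding F_def using eq[OF _ that] by blast
  qed
  have rep: "\<exists>a b. x = abs_pnat_fin a \<and> (a, b) \<in> gen H" for x
  proof -
    obtain a where "x = abs_pnat_fin a" using ex_pnat_fin by blast
    moreover obtain b where "(a, b) \<in> H" using total(1) by blast
    ultimately show ?thesis using gen.base by blast
  qed
  show ?thesis
  proof (rule that)
    show "F 1 = 1"
      unfolding one_pnat_fin_def one_ptree_ac_def by (rule F[OF gen.top])
    show "bij F"
    proof (rule bijI)
      show "inj F"
      proof (rule injI)
        fix x y assume "F x = F y"
        moreover obtain a b where x: "x = abs_pnat_fin a" "(a, b) \<in> gen H" using rep by blast
        moreover obtain a' b' where y: "y = abs_pnat_fin a'" "(a', b') \<in> gen H" using rep by blast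
        ultimately show "x = y" using eq[OF x(2) y(2)] F by simp
      qed
      show "surj F"
        unfolding surj_def
      proof
        fix y
        obtain b where b: "y = abs_ptree_ac b" using ex_ptree_ac by blast
        obtain a where "(a, b) \<in> H" using total(2) by blast
        then have "F (abs_pnat_fin a) = y" using F gen.base b by blast
        then show "\<exists>x. y = F x" by blast
      qed
    qed
    fix x y
    obtain a b where x: "x = abs_pnat_fin a" "(a, b) \<in> gen H" using rep by blast
    obtain a' b' where y: "y = abs_pnat_fin a'" "(a', b') \<in> gen H" using rep by blast
    show "F (x + y) = F x + F y"
      using F[OF sym[OF x(2) y(2)]] F[OF x(2)] F[OF y(2)]
      by (simp add: x(1) y(1) plus_pnat_fin.abs_eq plus_ptree_ac.abs_eq)
    show "F (x * y) = F x * F y"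
      using F[OF gen.Int[OF x(2) y(2)]] F[OF x(2)] F[OF y(2)]
      by (simp add: x(1) y(1) times_pnat_fin.abs_eq times_ptree_ac.abs_eq)
  qed
qed

section \<open>Matrix rings and their centres\<close>

lemma ring_mat_iso_of_bijection:
  fixes F :: "'a :: comm_ring_1 \<Rightarrow> 'b :: comm_ring_1"
  assumes F: "bij F" "F 1 = 1" "\<And>x y. F (x + y) = F x + F y" "\<And>x y. F (x * y) = F x * F y"
  shows "ring_mat TYPE('a) n () \<simeq> ring_mat TYPE('b) n ()"
proof -
  interpret F: comm_ring_hom F
  proof
    have "F 0 + F 0 = F 0 + 0" using F(3)[of 0 0] by simp
    then show "F 0 = 0" by simp
  qed (use F in auto)
  let ?h = "map_mat F"
  have "?h \<in> Ring.ring_hom (ring_mat TYPE('a) n ()) (ring_mat TYPE('b) n ())"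
    by (rule ring_hom_memI)
      (auto simp: ring_mat_simps F.mat_hom_mult F.mat_hom_one F.hom_add intro!: eq_matI)
  moreover have "bij_betw ?h (carrier (ring_mat TYPE('a) n ())) (carrier (ring_mat TYPE('b) n ()))"
  proof (rule bij_betw_byWitness[where f' = "map_mat (inv_into UNIV F)"])
    show "\<forall>A\<in>carrier (ring_mat TYPE('a) n ()). map_mat (inv_into UNIV F) (map_mat F A) = A"
      using F(1) by (auto intro!: eq_matI simp: ring_mat_simps bij_is_inj)
    show "\<forall>A\<in>carrier (ring_mat TYPE('b) n ()). map_mat F (map_mat (inv_into UNIV F) A) = A"
      using F(1) by (auto intro!: eq_matI simp: ring_mat_simps bij_is_surj surj_f_inv_f)
  qed (auto simp: ring_mat_simps)
  ultimately show ?thesis unfolding is_ring_iso_def ring_iso_def by blast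
qed

section \<open>The centre of a matrix ring\<close>

definition matrix_unit :: "nat \<Rightarrow> nat \<Rightarrow> nat \<Rightarrow> 'a :: comm_ring_1 mat" where
  "matrix_unit n a b = mat n n (\<lambda>(i, j). if i = a \<and> j = b then 1 else 0)"

lemma matrix_unit_carrier [simp]: "matrix_unit n a b \<in> carrier_mat n n"
  by (simp add: matrix_unit_def)

lemma index_mult_matrix_unit:
  assumes "X \<in> carrier_mat n n" "i < n" "j < n" "a < n"
  shows "(X * matrix_unit n a b) $$ (i, j) = (if j = b then X $$ (i, a) else 0)"
  using assms
  by (auto simp: matrix_unit_def scalar_prod_def if_distrib[of "\<lambda>x. _ * x"] sum.delta cong: if_cong)

lemma index_matrix_unit_mult:
  assumes "X \<in> carrier_mat n n" "i < n" "j < n" "b < n"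
  shows "(matrix_unit n a b * X) $$ (i, j) = (if i = a then X $$ (b, j) else 0)"
  using assms
  by (auto simp: matrix_unit_def scalar_prod_def if_distrib[of "\<lambda>x. x * _"] sum.delta cong: if_cong)

text \<open>Entry \<open>(i, 0)\<close> of the products with \<open>matrix_unit n j 0\<close> is
  \<open>X $$ (i, j)\<close> on one side, and \<open>X $$ (0, 0)\<close> or zero on the
  other.\<close>

lemma central_mat_eq_smult_one:
  fixes X :: "'a :: comm_ring_1 mat"
  assumes X: "X \<in> carrier_mat n n" and n: "0 < n"
    and comm: "\<And>Y. Y \<in> carrier_mat n n \<Longrightarrow> X * Y = Y * X"
  shows "X = X $$ (0, 0) \<cdot>\<^sub>m 1\<^sub>m n"
proof (rule eq_matI)
  fix i j assume "i < dim_row (X $$ (0, 0) \<cdot>\<^sub>m 1\<^sub>m n)" "j < dim_col (X $$ (0, 0) \<cdot>\<^sub>m 1\<^sub>m n)"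
  then have ij: "i < n" "j < n" by simp_all
  have "(X * matrix_unit n j 0) $$ (i, 0) = (matrix_unit n j 0 * X) $$ (i, 0)"
    by (simp only: comm[OF matrix_unit_carrier])
  then have "X $$ (i, j) = (if i = j then X $$ (0, 0) else 0)"
    using X ij n by (simp add: index_mult_matrix_unit index_matrix_unit_mult)
  then show "X $$ (i, j) = (X $$ (0, 0) \<cdot>\<^sub>m 1\<^sub>m n) $$ (i, j)" using ij by simp
qed (use X in auto)

lemma smult_one_commute:
  fixes A :: "'a :: comm_ring_1 mat"
  assumes "A \<in> carrier_mat n n"
  shows "(x \<cdot>\<^sub>m 1\<^sub>m n) * A = A * (x \<cdot>\<^sub>m 1\<^sub>m n)"
  using assms by (simp add: mult_smult_assoc_mat[of _ n n _ n] mult_smult_distrib[of _ n n _ n])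

lemma smult_one_mult: "(c \<cdot>\<^sub>m 1\<^sub>m n) * (d \<cdot>\<^sub>m 1\<^sub>m n) = (c * d :: 'a :: comm_ring_1) \<cdot>\<^sub>m 1\<^sub>m n"
proof -
  have "(c \<cdot>\<^sub>m 1\<^sub>m n) * (d \<cdot>\<^sub>m 1\<^sub>m n) = c \<cdot>\<^sub>m (d \<cdot>\<^sub>m 1\<^sub>m n)"
    by (simp add: mult_smult_assoc_mat[of _ n n _ n])
  then show ?thesis by auto
qed

lemma smult_one_add: "(c \<cdot>\<^sub>m 1\<^sub>m n) + (d \<cdot>\<^sub>m 1\<^sub>m n) = (c + d :: 'a :: comm_ring_1) \<cdot>\<^sub>m 1\<^sub>m n"
  by (rule eq_matI) (auto simp: algebra_simps)

lemma smult_one_inject: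
  assumes "0 < n" "(c :: 'a :: comm_ring_1) \<cdot>\<^sub>m 1\<^sub>m n = d \<cdot>\<^sub>m 1\<^sub>m n"
  shows "c = d"
proof -
  have "(c \<cdot>\<^sub>m 1\<^sub>m n) $$ (0, 0) = (d \<cdot>\<^sub>m 1\<^sub>m n) $$ (0, 0)" using assms(2) by simp
  then show ?thesis using assms(1) by simp
qed

text \<open>An isomorphism maps the centre onto the centre, and \<open>F\<close> is the induced map
  on scalars.\<close>

lemma bijection_of_ring_mat_iso:
  assumes n: "0 < n" and iso: "ring_mat TYPE('a :: comm_ring_1) n () \<simeq> ring_mat TYPE('b :: comm_ring_1) n ()"
  obtains F :: "'a :: comm_ring_1 \<Rightarrow> 'b :: comm_ring_1" where "bij F" "F 1 = 1" "\<And>x y. F (x + y) = F x + F y" "\<And>x y. F (x * y) = F x * F y"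
proof -
  obtain h where "h \<in> ring_iso (ring_mat TYPE('a) n ()) (ring_mat TYPE('b) n ())"
    using iso unfolding is_ring_iso_def by blast
  then have h: "h \<in> Ring.ring_hom (ring_mat TYPE('a) n ()) (ring_mat TYPE('b) n ())"
    and bij: "bij_betw h (carrier_mat n n) (carrier_mat n n)"
    by (auto simp: ring_iso_def ring_mat_simps)
  have carr: "h A \<in> carrier_mat n n" if "A \<in> carrier_mat n n" for A
    using bij that by (auto simp: bij_betw_def)
  have mult: "h (A * B) = h A * h B" if "A \<in> carrier_mat n n" "B \<in> carrier_mat n n" for A B
    using ring_hom_mult[OF h] that by (simp add: ring_mat_simps)
  have add: "h (A + B) = h A + h B" if "A \<in> carrier_mat n n" "B \<in> carrier_mat n n" for A B
    using ring_hom_add[OF h] that by (simp add: ring_mat_simps)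
  have one: "h (1\<^sub>m n) = 1\<^sub>m n"
    using ring_hom_one[OF h] by (simp add: ring_mat_simps)
  have inj: "A = B" if "h A = h B" "A \<in> carrier_mat n n" "B \<in> carrier_mat n n" for A B
    using bij that by (auto simp: bij_betw_def inj_on_def)
  have surj: "\<exists>A \<in> carrier_mat n n. h A = B" if "B \<in> carrier_mat n n" for B
    using bij that by (metis bij_betw_def imageE)
  define F where "F x = h (x \<cdot>\<^sub>m 1\<^sub>m n) $$ (0, 0)" for x
  have hF: "h (x \<cdot>\<^sub>m 1\<^sub>m n) = F x \<cdot>\<^sub>m 1\<^sub>m n" for x
    unfolding F_def
  proof (rule central_mat_eq_smult_one[OF carr n])
    fix Y :: "'b mat" assume "Y \<in> carrier_mat n n"
    then obtain A where A: "A \<in> carrier_mat n n" "h A = Y" using surj by blast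
    have "x \<cdot>\<^sub>m 1\<^sub>m n * A = A * (x \<cdot>\<^sub>m 1\<^sub>m n)"
      by (rule smult_one_commute[OF A(1)])
    then show "h (x \<cdot>\<^sub>m 1\<^sub>m n) * Y = Y * h (x \<cdot>\<^sub>m 1\<^sub>m n)"
      using mult[of "x \<cdot>\<^sub>m 1\<^sub>m n" A] mult[of A "x \<cdot>\<^sub>m 1\<^sub>m n"] A by simp
  qed simp
  show ?thesis
  proof (rule that)
    have "(1 :: 'a) \<cdot>\<^sub>m 1\<^sub>m n = 1\<^sub>m n" by auto
    then show "F 1 = 1" using one n by (simp add: F_def)
    show "F (x + y) = F x + F y" for x y
    proof (rule smult_one_inject[OF n])
      show "F (x + y) \<cdot>\<^sub>m 1\<^sub>m n = (F x + F y) \<cdot>\<^sub>m 1\<^sub>m n"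
        using add[of "x \<cdot>\<^sub>m 1\<^sub>m n" "y \<cdot>\<^sub>m 1\<^sub>m n"] by (simp add: smult_one_add hF)
    qed
    show "F (x * y) = F x * F y" for x y
    proof (rule smult_one_inject[OF n])
      show "F (x * y) \<cdot>\<^sub>m 1\<^sub>m n = (F x * F y) \<cdot>\<^sub>m 1\<^sub>m n"
        using mult[of "x \<cdot>\<^sub>m 1\<^sub>m n" "y \<cdot>\<^sub>m 1\<^sub>m n"] by (simp add: smult_one_mult hF)
    qed
    show "bij F"
    proof (rule bijI)
      show "inj F"
      proof (rule injI)
        fix x y assume "F x = F y"
        then have "h (x \<cdot>\<^sub>m 1\<^sub>m n) = h (y \<cdot>\<^sub>m 1\<^sub>m n)" by (simp add: hF)
        from inj[OF this] show "x = y" by (auto intro: smult_one_inject[OF n])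
      qed
      show "surj F"
        unfolding surj_def
      proof
        fix y
        obtain A where A: "A \<in> carrier_mat n n" "h A = y \<cdot>\<^sub>m 1\<^sub>m n"
          using surj[of "y \<cdot>\<^sub>m 1\<^sub>m n"] by auto
        \<comment> \<open>The image of \<open>A\<close> is scalar, hence commutes with every
          \<open>h B\<close>, and injectivity of \<open>h\<close> brings this back to
          \<open>A\<close>.\<close>
        have "A = A $$ (0, 0) \<cdot>\<^sub>m 1\<^sub>m n"
        proof (rule central_mat_eq_smult_one[OF A(1) n])
          fix B :: "'a mat" assume B: "B \<in> carrier_mat n n"
          have "(y \<cdot>\<^sub>m 1\<^sub>m n) * h B = h B * (y \<cdot>\<^sub>m 1\<^sub>m n)"
            by (rule smult_one_commute[OF carr[OF B]])
          then have "h (A * B) = h (B * A)" using mult A B by simp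
          then show "A * B = B * A" using A B by (intro inj) auto
        qed
        then have "F (A $$ (0, 0)) \<cdot>\<^sub>m 1\<^sub>m n = y \<cdot>\<^sub>m 1\<^sub>m n"
          using A(2) hF[of "A $$ (0, 0)"] by simp
        from smult_one_inject[OF n this] have "F (A $$ (0, 0)) = y" .
        then show "\<exists>x. y = F x" by blast
      qed
    qed
  qed
qed

section \<open>OCA for codes, and dominating families\<close>

lemma uncountable_pigeonhole:
  fixes f :: "'a \<Rightarrow> 'b :: countable"
  assumes "uncountable A"
  obtains c where "uncountable {x \<in> A. f x = c}"
proof -
  have "A = (\<Union>c. {x \<in> A. f x = c})" by blast
  then have "\<exists>c. uncountable {x \<in> A. f x = c}"
    using assms countable_UN[of UNIV "\<lambda>c. {x \<in> A. f x = c}"] by auto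
  then show ?thesis using that by blast
qed

text \<open>In base 3 with digits 0 and 1, all digits after the \<open>k\<close>-th together weigh
  half as much as the \<open>k\<close>-th. A differing digit thus cannot be compensated later, and
  nearby values share their first digits.\<close>

definition cantor_real :: "(nat \<Rightarrow> bool) \<Rightarrow> real" where
  "cantor_real z = (\<Sum>i. of_bool (z i) * (1/3) ^ i)"

lemma cantor_real_close:
  assumes "\<bar>cantor_real z - cantor_real w\<bar> < (1/3) ^ n / 2" "i < n"
  shows "z i = w i"
proof (rule ccontr)
  assume "z i \<noteq> w i"
  define k where "k = (LEAST k. z k \<noteq> w k)"
  have k: "z k \<noteq> w k" "k \<le> i"
    unfolding k_def using \<open>z i \<noteq> w i\<close> by (rule LeastI, rule Least_le)
  have less: "z j = w j" if "j < k" for j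
    using that not_less_Least unfolding k_def by blast
  define d :: "nat \<Rightarrow> real" where "d j = of_bool (z j) - of_bool (w j)" for j
  have d: "\<bar>d j\<bar> \<le> 1" for j by (auto simp: d_def)
  have geo: "summable (\<lambda>j. (1/3 :: real) ^ j)" by (rule summable_geometric) simp
  have sm: "summable (\<lambda>j. of_bool (v j) * (1/3 :: real) ^ j)" for v :: "nat \<Rightarrow> bool"
    by (rule summable_comparison_test'[OF geo, of 0]) auto
  have "summable (\<lambda>j. d j * (1/3) ^ j)"
    using summable_diff[OF sm[of z] sm[of w]] by (simp add: d_def left_diff_distrib)
  have eq: "cantor_real z - cantor_real w = (\<Sum>j. d j * (1/3) ^ j)"
    unfolding cantor_real_def using suminf_diff[OF sm[of z] sm[of w]]
    by (simp add: d_def left_diff_distrib)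
  also have "\<dots> = (\<Sum>j. d (j + Suc k) * (1/3) ^ (j + Suc k)) + (\<Sum>j<Suc k. d j * (1/3) ^ j)"
    by (rule suminf_split_initial_segment) fact
  also have "(\<Sum>j<Suc k. d j * (1/3) ^ j) = d k * (1/3) ^ k"
    using less by (simp add: d_def)
  finally have split: "cantor_real z - cantor_real w =
    (\<Sum>j. d (j + Suc k) * (1/3) ^ (j + Suc k)) + d k * (1/3) ^ k" .
  have tail_sm: "summable (\<lambda>j. (1/3 :: real) ^ Suc k * (1/3) ^ j)"
    by (rule summable_mult[OF geo])
  have le: "norm (d (j + Suc k) * (1/3) ^ (j + Suc k)) \<le> (1/3) ^ Suc k * (1/3) ^ j" for j
    using mult_right_mono[OF d[of "j + Suc k"], of "(1/3) ^ (j + Suc k)"]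
    by (simp add: abs_mult power_add mult.commute)
  have "norm (\<Sum>j. d (j + Suc k) * (1/3) ^ (j + Suc k)) \<le> (\<Sum>j. (1/3) ^ Suc k * (1/3) ^ j)"
    by (rule norm_suminf_le) (rule le, rule tail_sm)
  also have "\<dots> = (1/3) ^ Suc k * (3/2)"
    using suminf_mult[OF geo, of "(1/3) ^ Suc k"] suminf_geometric[of "1/3 :: real"] by simp
  finally have "\<bar>\<Sum>j. d (j + Suc k) * (1/3) ^ (j + Suc k)\<bar> \<le> (1/3) ^ k / 2" by simp
  moreover have "\<bar>d k * (1/3) ^ k\<bar> = (1/3) ^ k" using k by (auto simp: d_def abs_mult)
  ultimately have "(1/3) ^ k / 2 \<le> \<bar>cantor_real z - cantor_real w\<bar>"
    unfolding split by linarith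
  moreover have "(1/3 :: real) ^ n \<le> (1/3) ^ k"
    using k(2) assms(2) by (intro power_decreasing) auto
  ultimately show False using assms(1) by linarith
qed

text \<open>This moves OCA from sets of reals to any set whose points are told apart by countably
  many yes-no tests, with finitely many test results as basic neighbourhoods. The results are coded
  as a real by \<open>cantor_real\<close>.\<close>

lemma OCA_tests:
  fixes c :: "'a \<Rightarrow> 't :: countable \<Rightarrow> bool"
  assumes OCA: OCA and inj: "inj_on c X"
    and sym: "\<And>a b. K a b \<Longrightarrow> K b a" and irrefl: "\<And>a. \<not> K a a"
    and op: "\<And>a b. a \<in> X \<Longrightarrow> b \<in> X \<Longrightarrow> K a b \<Longrightarrow> \<exists>F. finite F \<and>
      (\<forall>a'\<in>X. \<forall>b'\<in>X. (\<forall>t\<in>F. c a' t = c a t) \<longrightarrow> (\<forall>t\<in>F. c b' t = c b t) \<longrightarrow> K a' b')"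
  shows "(\<exists>Y\<subseteq>X. uncountable Y \<and> (\<forall>a\<in>Y. \<forall>b\<in>Y. a \<noteq> b \<longrightarrow> K a b)) \<or>
    (\<exists>H :: nat \<Rightarrow> 'a set. X = (\<Union>k. H k) \<and> (\<forall>k. \<forall>a\<in>H k. \<forall>b\<in>H k. \<not> K a b))"
proof -
  define e where "e a = cantor_real (\<lambda>i. c a (from_nat i))" for a
  \<comment> \<open>Nearness of codes gives agreement on any given finite set of tests; this makes
    \<open>e\<close> injective on \<open>X\<close> and turns \<open>op\<close> into
    openness.\<close>
  have close: "\<exists>\<delta>>0. \<forall>a b. \<bar>e a - e b\<bar> < \<delta> \<longrightarrow> (\<forall>t\<in>F. c a t = c b t)" if fin: "finite F" for F
  proof -
    obtain n where n: "\<forall>t\<in>F. to_nat t < n"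
      using fin finite_nat_set_iff_bounded[of "to_nat ` F"] by auto
    show ?thesis
    proof (intro exI conjI allI impI ballI)
      show "0 < (1/3 :: real) ^ n / 2" by simp
      fix a b t assume "\<bar>e a - e b\<bar> < (1/3) ^ n / 2" "t \<in> F"
      then show "c a t = c b t"
        using cantor_real_close[of "\<lambda>i. c a (from_nat i)" "\<lambda>i. c b (from_nat i)" n "to_nat t"] n
        by (simp add: e_def)
    qed
  qed
  have inj_e: "inj_on e X"
  proof (rule inj_onI)
    fix a b assume ab: "a \<in> X" "b \<in> X" "e a = e b"
    have "c a t = c b t" for t
    proof -
      obtain \<delta> where "0 < \<delta>" "\<And>a b. \<bar>e a - e b\<bar> < \<delta> \<Longrightarrow> c a t = c b t"
        using close[of "{t}"] by auto
      then show ?thesis using ab(3) by simp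
    qed
    then have "c a = c b" by (rule ext)
    then show "a = b" using inj_onD[OF inj] ab by blast
  qed
  define K\<^sub>0 where "K\<^sub>0 = {{e a, e b} | a b. a \<in> X \<and> b \<in> X \<and> K a b}"
  define K\<^sub>1 where "K\<^sub>1 = {{e a, e b} | a b. a \<in> X \<and> b \<in> X \<and> a \<noteq> b \<and> \<not> K a b}"
  have K0: "{e a, e b} \<in> K\<^sub>0 \<longleftrightarrow> K a b" if "a \<in> X" "b \<in> X" for a b
  proof
    assume "{e a, e b} \<in> K\<^sub>0"
    then obtain a' b' where "a' \<in> X" "b' \<in> X" "K a' b'" "{e a, e b} = {e a', e b'}"
      unfolding K\<^sub>0_def by blast
    then show "K a b" using that inj_e sym by (metis doubleton_eq_iff inj_onD)
  qed (use that in \<open>auto simp: K\<^sub>0_def\<close>)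
  have K1: "\<not> K a b" if ab: "{e a, e b} \<in> K\<^sub>1" "a \<in> X" "b \<in> X" for a b
  proof -
    obtain a' b' where "a' \<in> X" "b' \<in> X" "\<not> K a' b'" "{e a, e b} = {e a', e b'}"
      using ab(1) unfolding K\<^sub>1_def by blast
    then show ?thesis using ab(2,3) inj_e sym by (metis doubleton_eq_iff inj_onD)
  qed
  have "[e ` X]\<^bsup>2\<^esup> = K\<^sub>0 \<union> K\<^sub>1"
  proof
    show "[e ` X]\<^bsup>2\<^esup> \<subseteq> K\<^sub>0 \<union> K\<^sub>1"
      unfolding nsets_2_eq K\<^sub>0_def K\<^sub>1_def by blast
    have "{e a, e b} \<in> [e ` X]\<^bsup>2\<^esup>" if "a \<in> X" "b \<in> X" "K a b \<or> a \<noteq> b" for a b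
    proof -
      have "a \<noteq> b" using that irrefl by blast
      then have "e a \<noteq> e b" using inj_onD[OF inj_e] that by blast
      then show ?thesis using that by (simp add: nsets_2_eq) blast
    qed
    then show "K\<^sub>0 \<union> K\<^sub>1 \<subseteq> [e ` X]\<^bsup>2\<^esup>"
      unfolding K\<^sub>0_def K\<^sub>1_def by blast
  qed
  moreover have "openin (top_of_set (e ` X \<times> e ` X))
      {(x, y). x \<in> e ` X \<and> y \<in> e ` X \<and> {x, y} \<in> K\<^sub>0}"
    unfolding openin_euclidean_subtopology_iff
  proof (intro conjI ballI)
    fix z assume "z \<in> {(x, y). x \<in> e ` X \<and> y \<in> e ` X \<and> {x, y} \<in> K\<^sub>0}"
    then obtain a b where z: "z = (e a, e b)" "a \<in> X" "b \<in> X" "K a b" using K0 by blast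
    from op[OF z(2-4)] obtain F where F: "finite F"
      "\<forall>a'\<in>X. \<forall>b'\<in>X. (\<forall>t\<in>F. c a' t = c a t) \<longrightarrow> (\<forall>t\<in>F. c b' t = c b t) \<longrightarrow> K a' b'"
      by (elim exE conjE)
    from close[OF F(1)] obtain \<delta> where \<delta>: "0 < \<delta>"
      "\<forall>a b. \<bar>e a - e b\<bar> < \<delta> \<longrightarrow> (\<forall>t\<in>F. c a t = c b t)"
      by (elim exE conjE)
    show "\<exists>\<epsilon>>0. \<forall>z'\<in>e ` X \<times> e ` X. dist z' z < \<epsilon> \<longrightarrow>
        z' \<in> {(x, y). x \<in> e ` X \<and> y \<in> e ` X \<and> {x, y} \<in> K\<^sub>0}"
    proof (intro exI conjI ballI impI)
      show "0 < \<delta>" by fact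
      fix z' assume "z' \<in> e ` X \<times> e ` X" and dist: "dist z' z < \<delta>"
      then obtain a' b' where z': "z' = (e a', e b')" "a' \<in> X" "b' \<in> X" by auto
      have "dist (e a') (e a) < \<delta>" "dist (e b') (e b) < \<delta>"
        using dist dist_fst_le[of z' z] dist_snd_le[of z' z] z z' by auto
      then have "\<forall>t\<in>F. c a' t = c a t" "\<forall>t\<in>F. c b' t = c b t"
        using \<delta>(2) by (simp_all add: dist_real_def)
      then have "K a' b'" using F(2)[rule_format, OF z'(2,3)] by blast
      then show "z' \<in> {(x, y). x \<in> e ` X \<and> y \<in> e ` X \<and> {x, y} \<in> K\<^sub>0}" using z' K0 by auto
    qed
  qed auto
  ultimately have "(\<exists>Y \<subseteq> e ` X. uncountable Y \<and> [Y]\<^bsup>2\<^esup> \<subseteq> K\<^sub>0) \<or>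
      (\<exists>H :: nat \<Rightarrow> real set. e ` X = (\<Union>k. H k) \<and> (\<forall>k. [H k]\<^bsup>2\<^esup> \<subseteq> K\<^sub>1))"
    using OCA[unfolded OCA_def, rule_format, of "e ` X" K\<^sub>0 K\<^sub>1] by (simp only: simp_thms)
  then show ?thesis
  proof (elim disjE exE conjE)
    fix Y assume Y: "Y \<subseteq> e ` X" "uncountable Y" "[Y]\<^bsup>2\<^esup> \<subseteq> K\<^sub>0"
    obtain Y' where Y': "Y' \<subseteq> X" "Y = e ` Y'" using Y(1) by (metis subset_imageE)
    have "uncountable Y'" using Y(2) Y'(2) by auto
    moreover have "K a b" if ab: "a \<in> Y'" "b \<in> Y'" "a \<noteq> b" for a b
    proof -
      have "e a \<noteq> e b" using ab Y'(1) inj_e by (metis inj_onD subsetD)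
      then have "{e a, e b} \<in> [Y]\<^bsup>2\<^esup>" using ab Y'(2) by (auto simp: nsets_2_eq)
      then show ?thesis using Y(3) K0 ab Y'(1) by blast
    qed
    ultimately show ?thesis using Y'(1) by (intro disjI1 exI[of _ Y'] conjI ballI impI)
  next
    fix H :: "nat \<Rightarrow> real set"
    assume H: "e ` X = (\<Union>k. H k)" "\<forall>k. [H k]\<^bsup>2\<^esup> \<subseteq> K\<^sub>1"
    have XH: "X = (\<Union>k. {a \<in> X. e a \<in> H k})" using equalityD1[OF H(1)] by blast
    have nK: "\<not> K a b" if ab: "a \<in> X" "b \<in> X" "e a \<in> H k" "e b \<in> H k" for a b k
    proof (cases "a = b")
      case False
      then have "e a \<noteq> e b" using ab inj_e by (metis inj_onD)
      then have "{e a, e b} \<in> [H k]\<^bsup>2\<^esup>" using ab by (auto simp: nsets_2_eq)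
      then show ?thesis using H(2) K1 ab by blast
    qed (use irrefl in simp)
    show ?thesis
      by (intro disjI2 exI[of _ "\<lambda>k. {a \<in> X. e a \<in> H k}"] conjI allI ballI, rule XH) (use nK in blast)
  qed
qed

text \<open>Like the non-dominating families, the families that are not strongly dominating form a
  \<open>\<sigma>\<close>-ideal; only the strong version yields a stem beyond which arbitrary lower bounds
  can be met exactly, rather than from some point on.\<close>

definition strongly_dominating :: "(nat \<Rightarrow> nat) set \<Rightarrow> bool" where
  "strongly_dominating Q \<longleftrightarrow>
    (\<forall>\<phi> :: nat list \<Rightarrow> nat. \<exists>q\<in>Q. \<exists>n. \<forall>j\<ge>n. \<phi> (map q [0..<j]) \<le> q j)"

text \<open>If every \<open>Q k\<close> had a counterexample \<open>\<phi> k\<close>, the maximum of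
  the first \<open>length s + 1\<close> of them would eventually bound each one, and so defeat the
  union.\<close>

lemma strongly_dominating_UN:
  assumes "strongly_dominating (\<Union>k::nat. Q k)"
  shows "\<exists>k. strongly_dominating (Q k)"
proof (rule ccontr)
  assume "\<not> ?thesis"
  then have "\<forall>k. \<exists>\<phi>. \<forall>q\<in>Q k. \<not> (\<exists>n. \<forall>j\<ge>n. \<phi> (map q [0..<j]) \<le> q j)"
    unfolding strongly_dominating_def by blast
  from choice[OF this] obtain \<phi> where
    \<phi>: "\<forall>k. \<forall>q\<in>Q k. \<not> (\<exists>n. \<forall>j\<ge>n. \<phi> k (map q [0..<j]) \<le> q j)" by (rule exE)
  define \<psi> where "\<psi> s = Max ((\<lambda>k. \<phi> k s) ` {..length s})" for s
  obtain q n k where q: "q \<in> Q k" "\<And>j. j \<ge> n \<Longrightarrow> \<psi> (map q [0..<j]) \<le> q j"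
    using assms[unfolded strongly_dominating_def, rule_format, of \<psi>] by auto
  have "\<phi> k (map q [0..<j]) \<le> q j" if "j \<ge> max n k" for j
  proof -
    have "\<phi> k (map q [0..<j]) \<le> \<psi> (map q [0..<j])"
      unfolding \<psi>_def using that by (intro Max_ge) auto
    then show ?thesis using q(2)[of j] that by simp
  qed
  then show False using \<phi> q(1) by blast
qed

text \<open>If every stem \<open>s\<close> had a counterexample \<open>\<phi> s\<close>, then
  \<open>\<psi>\<close>, which at \<open>t\<close> takes the maximum over all stems that are
  prefixes of \<open>t\<close>, would be obeyed by some \<open>q\<close> from \<open>n\<close> on.
  This refutes the counterexample for the stem of \<open>q\<close> of length
  \<open>n\<close>.\<close>

lemma strongly_dominating_stem:
  assumes "strongly_dominating Q"
  shows "\<exists>s. \<forall>\<phi> :: nat list \<Rightarrow> nat.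
    \<exists>q\<in>Q. map q [0..<length s] = s \<and> (\<forall>j\<ge>length s. \<phi> (map q [0..<j]) \<le> q j)"
proof (rule ccontr)
  assume "\<not> ?thesis"
  then have "\<forall>s. \<exists>\<phi>. \<forall>q\<in>Q. map q [0..<length s] = s \<longrightarrow>
      \<not> (\<forall>j\<ge>length s. \<phi> (map q [0..<j]) \<le> q j)" by blast
  from choice[OF this] obtain \<phi> where \<phi>: "\<forall>s. \<forall>q\<in>Q. map q [0..<length s] = s \<longrightarrow>
      \<not> (\<forall>j\<ge>length s. \<phi> s (map q [0..<j]) \<le> q j)" by (rule exE)
  define \<psi> where "\<psi> t = Max ((\<lambda>k. \<phi> (take k t) t) ` {..length t})" for t
  obtain q n where q: "q \<in> Q" "\<And>j. j \<ge> n \<Longrightarrow> \<psi> (map q [0..<j]) \<le> q j"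
    using assms[unfolded strongly_dominating_def, rule_format, of \<psi>] by auto
  let ?s = "map q [0..<n]"
  have "\<phi> ?s (map q [0..<j]) \<le> q j" if "j \<ge> n" for j
  proof -
    have "take n (map q [0..<j]) = ?s" using that by (simp add: take_map)
    then have "\<phi> ?s (map q [0..<j]) \<le> \<psi> (map q [0..<j])"
      unfolding \<psi>_def using that by (intro Max_ge) (auto intro!: image_eqI[of _ _ n])
    then show ?thesis using q(2)[OF that] by simp
  qed
  then show False using \<phi>[rule_format, OF q(1), of ?s] by simp
qed

text \<open>A form of the fact that OCA makes the bounding number exceed aleph_1. A counterexample
  is turned into monotone functions \<open>h x\<close>, strictly increasing modulo finite along
  omega_1 and with no bounded uncountable subfamily.\<close>

lemma OCA_bounding:
  fixes Z :: "(nat \<Rightarrow> bool) set" and f :: "(nat \<Rightarrow> bool) \<Rightarrow> nat \<Rightarrow> nat"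
  assumes OCA: OCA and unc: "uncountable Z"
  shows "\<exists>Z' \<subseteq> Z. \<exists>g. uncountable Z' \<and> (\<forall>x\<in>Z'. \<exists>n. \<forall>j\<ge>n. f x j \<le> g j)"
proof (rule ccontr)
  assume "\<not> ?thesis"
  then have contr: "\<not> (\<forall>x\<in>Z'. \<exists>n. \<forall>j\<ge>n. f x j \<le> g j)"
    if "Z' \<subseteq> Z" "uncountable Z'" for Z' g using that by blast
  obtain Z\<^sub>1 r where Z1: "Z\<^sub>1 \<subseteq> Z" "uncountable Z\<^sub>1" and r: "wf r" "trans r" "total_on Z\<^sub>1 r" "r \<subseteq> Z\<^sub>1 \<times> Z\<^sub>1"
    and seg: "\<And>x. countable {y. (y, x) \<in> r}"
    using ex_uncountable_countable_segments[OF unc] by metis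
  define P where "P h x p \<longleftrightarrow> mono p \<and> f x \<le> p \<and> (\<forall>y. (y, x) \<in> r \<longrightarrow> (\<exists>n. \<forall>j\<ge>n. h y j < p j))"
    for h :: "(nat \<Rightarrow> bool) \<Rightarrow> nat \<Rightarrow> nat" and x and p :: "nat \<Rightarrow> nat"
  have "\<exists>h. \<forall>x. P h x (h x)"
  proof (rule dependent_wf_choice[OF r(1)])
    show "P h x p = P h' x p" if "\<And>z. (z, x) \<in> r \<Longrightarrow> h z = h' z" for h h' x p
      using that by (simp add: P_def)
    fix x and h :: "(nat \<Rightarrow> bool) \<Rightarrow> nat \<Rightarrow> nat"
    let ?S = "h ` {y. (y, x) \<in> r}"
    define s where "s = from_nat_into (insert (f x) ?S)"
    have ran: "range s = insert (f x) ?S"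
      unfolding s_def using seg[of x] by (intro range_from_nat_into) auto
    \<comment> \<open>The sum over \<open>i \<le> j\<close> makes \<open>p\<close> monotone, and the
      sum over \<open>k \<le> i\<close> puts it eventually above each of the countably many earlier
      functions.\<close>
    define p where "p j = Suc (\<Sum>i\<le>j. f x i + (\<Sum>k\<le>i. s k i))" for j
    have "mono p"
      unfolding p_def by (intro monoI Suc_le_mono[THEN iffD2] sum_mono2) auto
    moreover have le: "f x j + (\<Sum>k\<le>j. s k j) < p j" for j
      unfolding p_def less_Suc_eq_le by (rule member_le_sum) auto
    then have "f x \<le> p" by (intro le_funI) (metis add_leD1 less_imp_le)
    moreover have "\<exists>n. \<forall>j\<ge>n. h y j < p j" if "(y, x) \<in> r" for y
    proof -
      have "h y \<in> range s" using that ran by blast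
      then obtain k where k: "h y = s k" by blast
      have "h y j < p j" if "j \<ge> k" for j
      proof -
        have "s k j \<le> (\<Sum>k\<le>j. s k j)" using that by (intro member_le_sum) auto
        then show ?thesis using le[of j] k by simp
      qed
      then show ?thesis by blast
    qed
    ultimately show "\<exists>p. P h x p" unfolding P_def by blast
  qed
  then obtain h where h: "\<forall>x. P h x (h x)" by (rule exE)
  have mono: "mono (h x)" and ge: "f x j \<le> h x j" for x j
    using h by (auto simp: P_def le_fun_def)
  have below: "\<exists>n. \<forall>j\<ge>n. h y j < h x j" if "(y, x) \<in> r" for x y
    using h that by (simp add: P_def)
  have unb: "countable Y" if Y: "Y \<subseteq> Z\<^sub>1" "\<forall>x\<in>Y. \<exists>n. \<forall>j\<ge>n. h x j \<le> g j" for Y g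
  proof (rule ccontr)
    assume "uncountable Y"
    moreover have "Y \<subseteq> Z" using Y(1) Z1(1) by (rule subset_trans)
    ultimately have "\<not> (\<forall>x\<in>Y. \<exists>n. \<forall>j\<ge>n. f x j \<le> g j)" by (rule contr[rotated])
    moreover have "\<exists>n. \<forall>j\<ge>n. f x j \<le> g j" if x: "x \<in> Y" for x
    proof -
      obtain n where "\<forall>j\<ge>n. h x j \<le> g j" using Y(2) x by blast
      then have "\<forall>j\<ge>n. f x j \<le> g j" using ge[of x] by (auto intro: order_trans)
      then show ?thesis by blast
    qed
    ultimately show False by blast
  qed
  \<comment> \<open>Incomparability in the pointwise order is open; a pointwise chain that is strictly
    increasing modulo finite sets is countable.\<close>
  define K where "K x y \<longleftrightarrow> (\<exists>n. h y n < h x n) \<and> (\<exists>n. h x n < h y n)" for x y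
  define c where "c x t = (case t of Inl i \<Rightarrow> x i | Inr (i, j) \<Rightarrow> h x i = j)"
    for x and t :: "nat + nat \<times> nat"
  have "(\<exists>Y\<subseteq>Z\<^sub>1. uncountable Y \<and> (\<forall>a\<in>Y. \<forall>b\<in>Y. a \<noteq> b \<longrightarrow> K a b)) \<or>
    (\<exists>H :: nat \<Rightarrow> _ set. Z\<^sub>1 = (\<Union>k. H k) \<and> (\<forall>k. \<forall>a\<in>H k. \<forall>b\<in>H k. \<not> K a b))"
  proof (rule OCA_tests[OF OCA, where c = c])
    show "inj_on c Z\<^sub>1"
    proof (rule inj_onI)
      fix x y assume "c x = c y"
      then have "c x (Inl i) = c y (Inl i)" for i by simp
      then show "x = y" by (auto simp: c_def)
    qed
    show "K b a" if "K a b" for a b using that by (auto simp: K_def)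
    show "\<not> K a a" for a by (auto simp: K_def)
    fix a b assume "K a b"
    then obtain m n where mn: "h b m < h a m" "h a n < h b n" by (auto simp: K_def)
    show "\<exists>F. finite F \<and> (\<forall>a'\<in>Z\<^sub>1. \<forall>b'\<in>Z\<^sub>1. (\<forall>t\<in>F. c a' t = c a t) \<longrightarrow>
        (\<forall>t\<in>F. c b' t = c b t) \<longrightarrow> K a' b')"
    proof (intro exI conjI ballI impI)
      let ?F = "{Inr (m, h a m), Inr (m, h b m), Inr (n, h a n), Inr (n, h b n)}"
      show "finite ?F" by simp
      fix a' b' assume "\<forall>t\<in>?F. c a' t = c a t" "\<forall>t\<in>?F. c b' t = c b t"
      then have "h a' m = h a m" "h a' n = h a n" "h b' m = h b m" "h b' n = h b n"
        by (simp_all add: c_def)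
      then show "K a' b'" using mn unfolding K_def by metis
    qed
  qed
  then show False
  proof (elim disjE exE conjE)
    fix Y assume Y: "Y \<subseteq> Z\<^sub>1" "uncountable Y" "\<forall>a\<in>Y. \<forall>b\<in>Y. a \<noteq> b \<longrightarrow> K a b"
    \<comment> \<open>One representative for each finite stem occurring in \<open>Y\<close> gives a
      countable dense subset \<open>D\<close>.\<close>
    define pick where "pick t = (SOME d. d \<in> Y \<and> map (h d) [0..<length t] = t)" for t
    define D where "D = range pick \<inter> Y"
    have D: "countable D" "D \<subseteq> Y" by (auto simp: D_def)
    have dense: "\<exists>d\<in>D. \<forall>j<n. h d j = h x j" if "x \<in> Y" for x n
    proof -
      let ?t = "map (h x) [0..<n]"
      have "pick ?t \<in> Y \<and> map (h (pick ?t)) [0..<length ?t] = ?t"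
        unfolding pick_def by (rule someI[of _ x]) (use that in simp)
      then have "pick ?t \<in> D" "\<forall>j<n. h (pick ?t) j = h x j"
        unfolding D_def by (simp_all add: map_eq_conv)
      then show ?thesis by blast
    qed
    \<comment> \<open>A point \<open>y\<close> outside \<open>C\<close> comes after all of
      \<open>D\<close>, so each \<open>h d\<close> is eventually below \<open>h y\<close>.\<close>
    define C where "C = (\<Union>d\<in>D. insert d {y. (y, d) \<in> r})"
    have "countable C" unfolding C_def using D(1) seg by auto
    then have "\<not> Z\<^sub>1 \<subseteq> C" using Z1(2) countable_subset by metis
    then obtain y where y: "y \<in> Z\<^sub>1" "y \<notin> C" by blast
    have Dy: "(d, y) \<in> r" if "d \<in> D" for d
    proof -
      have "d \<in> Z\<^sub>1" "d \<noteq> y" "(y, d) \<notin> r" using that y(2) D(2) Y(1) by (auto simp: C_def)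
      then show ?thesis using y(1) r(3) by (auto simp: total_on_def)
    qed
    define Y\<^sub>1 where "Y\<^sub>1 = {x \<in> Y. (y, x) \<in> r}"
    have "Y \<subseteq> Y\<^sub>1 \<union> insert y {x. (x, y) \<in> r}"
    proof
      fix x assume x: "x \<in> Y"
      then have "x \<in> Z\<^sub>1" using Y(1) by blast
      then show "x \<in> Y\<^sub>1 \<union> insert y {x. (x, y) \<in> r}"
        using x r(3) y(1) unfolding total_on_def Y\<^sub>1_def by auto
    qed
    then have unc1: "uncountable Y\<^sub>1"
      using Y(2) seg[of y] countable_subset[of Y "Y\<^sub>1 \<union> insert y {x. (x, y) \<in> r}"] by auto
    have "\<forall>x\<in>Y\<^sub>1. \<exists>n. \<forall>j\<ge>n. h y j < h x j" using below by (simp add: Y\<^sub>1_def)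
    from bchoice[OF this] obtain N where N: "\<forall>x\<in>Y\<^sub>1. \<forall>j\<ge>N x. h y j < h x j" by (rule exE)
    from unc1 obtain nt where "uncountable {x \<in> Y\<^sub>1. (N x, map (h x) [0..<N x]) = nt}"
      by (rule uncountable_pigeonhole)
    moreover obtain n t where "nt = (n, t)" by (cases nt)
    ultimately have unc2: "uncountable {x \<in> Y\<^sub>1. (N x, map (h x) [0..<N x]) = (n, t)}" by simp
    \<comment> \<open>On \<open>Y\<^sub>2\<close> the functions exceed \<open>h y\<close> from the
      common point \<open>n\<close> on, and they agree below \<open>n\<close>.\<close>
    define Y\<^sub>2 where "Y\<^sub>2 = {x \<in> Y\<^sub>1. (N x, map (h x) [0..<N x]) = (n, t)}"
    have Y2: "uncountable Y\<^sub>2" "Y\<^sub>2 \<subseteq> Y" using unc2 by (auto simp: Y\<^sub>2_def Y\<^sub>1_def)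
    have Y2n: "h y j < h x j" if "x \<in> Y\<^sub>2" "j \<ge> n" for x j
      using that N by (auto simp: Y\<^sub>2_def)
    have Y2t: "map (h x) [0..<n] = t" if "x \<in> Y\<^sub>2" for x
      using that by (auto simp: Y\<^sub>2_def)
    have "\<exists>m. infinite ((\<lambda>x. h x m) ` Y\<^sub>2)"
    proof (rule ccontr)
      assume "\<not> ?thesis"
      then have fin: "finite ((\<lambda>x. h x m) ` Y\<^sub>2)" for m by blast
      have "h x j \<le> Max ((\<lambda>x. h x j) ` Y\<^sub>2)" if "x \<in> Y\<^sub>2" for x j
        using that by (intro Max_ge[OF fin]) auto
      then have "countable Y\<^sub>2"
        using Y2(2) Y(1) by (intro unb[of _ "\<lambda>j. Max ((\<lambda>x. h x j) ` Y\<^sub>2)"]) auto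
      then show False using Y2(1) by blast
    qed
    \<comment> \<open>At the first coordinate \<open>m\<close> with infinitely many values only
      finitely many stems of length \<open>m\<close> occur, so a single stem \<open>u\<close> admits
      infinitely many values at \<open>m\<close>.\<close>
    then have "\<exists>m. infinite ((\<lambda>x. h x m) ` Y\<^sub>2) \<and> (\<forall>j<m. \<not> infinite ((\<lambda>x. h x j) ` Y\<^sub>2))"
      by (subst (asm) exists_least_iff)
    then obtain m where m: "infinite ((\<lambda>x. h x m) ` Y\<^sub>2)"
      and mmin: "\<forall>j<m. finite ((\<lambda>x. h x j) ` Y\<^sub>2)" by blast
    have "n \<le> m"
    proof (rule ccontr)
      assume "\<not> n \<le> m"
      then have "h x m = t ! m" if "x \<in> Y\<^sub>2" for x
        using Y2t[OF that] by auto
      then have "(\<lambda>x. h x m) ` Y\<^sub>2 \<subseteq> {t ! m}" by auto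
      then show False using m finite_subset by blast
    qed
    let ?T = "(\<lambda>x. map (h x) [0..<m]) ` Y\<^sub>2"
    define B where "B = (\<Union>j<m. (\<lambda>x. h x j) ` Y\<^sub>2)"
    have "h x j \<in> B" if "x \<in> Y\<^sub>2" "j < m" for x j
      unfolding B_def using that imageI[of x Y\<^sub>2 "\<lambda>x. h x j"] by (intro UN_I[of j]) simp_all
    then have "?T \<subseteq> {u. set u \<subseteq> B \<and> length u = m}" by auto
    moreover have "finite {u. set u \<subseteq> B \<and> length u = m}"
      using mmin by (intro finite_lists_length_eq) (auto simp: B_def)
    ultimately have "finite ?T" by (rule finite_subset)
    define E where "E u = (\<lambda>x. h x m) ` {x \<in> Y\<^sub>2. map (h x) [0..<m] = u}" for u
    have "(\<lambda>x. h x m) ` Y\<^sub>2 \<subseteq> (\<Union>u\<in>?T. E u)"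
      unfolding E_def by blast
    with m have "infinite (\<Union>u\<in>?T. E u)" using finite_subset by blast
    with \<open>finite ?T\<close> have "\<not> (\<forall>u\<in>?T. finite (E u))" by (metis finite_UN_I)
    then obtain u where u: "u \<in> ?T" "infinite (E u)" by blast
    obtain x\<^sub>0 where x0: "x\<^sub>0 \<in> Y\<^sub>2" "map (h x\<^sub>0) [0..<m] = u" using u(1) by blast
    obtain d where d: "d \<in> D" "\<forall>j<m. h d j = h x\<^sub>0 j"
      using dense[of x\<^sub>0 m] x0(1) Y2(2) by blast
    obtain l where l: "\<forall>j\<ge>l. h d j < h y j" using below[OF Dy[OF d(1)]] by blast
    \<comment> \<open>This makes \<open>h d\<close> lie pointwise below \<open>h x\<close>: they
      agree below \<open>m\<close>, monotonicity settles the range up to \<open>max l m\<close>, and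
      beyond it \<open>h y\<close> lies between them. So \<open>d\<close> and \<open>x\<close> are
      not joined by \<open>K\<close>.\<close>
    obtain x where x: "x \<in> Y\<^sub>2" "map (h x) [0..<m] = u" "h d (max l m) < h x m"
    proof -
      have "\<not> E u \<subseteq> {..h d (max l m)}" using u(2) finite_subset finite_atMost by blast
      then obtain v where "v \<in> E u" "\<not> v \<le> h d (max l m)" unfolding subset_iff atMost_iff by blast
      then have "v \<in> E u" "h d (max l m) < v" by (simp_all add: not_le)
      then show ?thesis using that unfolding E_def by blast
    qed
    have "h d j \<le> h x j" for j
    proof -
      consider "j < m" | "m \<le> j" "j \<le> max l m" | "max l m < j" by linarith
      then show ?thesis
      proof cases
        case 1
        have "h x j = u ! j" "h x\<^sub>0 j = u ! j" using 1 x(2) x0(2) by auto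
        then show ?thesis using d(2) 1 by simp
      next
        case 2
        have "h d j \<le> h d (max l m)" using mono 2(2) by (rule monoD)
        also have "\<dots> \<le> h x m" using x(3) by simp
        also have "\<dots> \<le> h x j" using mono 2(1) by (rule monoD)
        finally show ?thesis .
      next
        case 3
        then show ?thesis using l[rule_format, of j] Y2n[OF x(1), of j] \<open>n \<le> m\<close> by simp
      qed
    qed
    then have "\<not> K d x" by (auto simp: K_def not_less)
    moreover have "d \<noteq> x"
    proof
      assume "d = x"
      then have "h x (max l m) < h x m" using x(3) by simp
      moreover have "h x m \<le> h x (max l m)" using mono by (rule monoD) simp
      ultimately show False by simp
    qed
    ultimately show False using Y(3) d(1) D(2) x(1) Y2(2) by blast
  next
    fix H :: "nat \<Rightarrow> (nat \<Rightarrow> bool) set"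
    assume H: "Z\<^sub>1 = (\<Union>k. H k)" "\<forall>k. \<forall>a\<in>H k. \<forall>b\<in>H k. \<not> K a b"
    obtain k where k: "uncountable (H k)" using Z1(2) H(1) by (metis countable_UN countableI_type)
    have sub: "H k \<subseteq> Z\<^sub>1" using H(1) by blast
    have le: "h x j \<le> h y j" if xy: "x \<in> H k" "y \<in> H k" "(x, y) \<in> r" for x y j
    proof -
      obtain n where "h x n < h y n" using below[OF xy(3)] by blast
      then have "\<not> (\<exists>n. h y n < h x n)" using H(2) xy(1,2) unfolding K_def by blast
      then show ?thesis by (simp add: not_less)
    qed
    have later: "\<exists>y\<in>H k. (x, y) \<in> r" if "x \<in> H k" for x
    proof (rule ccontr)
      assume "\<not> ?thesis"
      then have "H k \<subseteq> insert x {y. (y, x) \<in> r}"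
        using r(3) sub that unfolding total_on_def by auto
      then show False using k seg[of x] countable_subset[of "H k" "insert x {y. (y, x) \<in> r}"] by auto
    qed
    \<comment> \<open>A coordinate where the immediate successor of \<open>x\<close> in the piece
      exceeds it works for all later members, since the piece is a pointwise chain.\<close>
    have ex: "\<exists>j. \<forall>y\<in>H k. (x, y) \<in> r \<longrightarrow> h x j < h y j" if x: "x \<in> H k" for x
    proof -
      obtain y where "y \<in> {y \<in> H k. (x, y) \<in> r}" using later[OF x] by blast
      from r(1)[unfolded wf_eq_minimal, rule_format, OF this]
      obtain m where m: "m \<in> H k" "(x, m) \<in> r"
        and min: "\<forall>z. (z, m) \<in> r \<longrightarrow> z \<in> H k \<longrightarrow> (x, z) \<notin> r" by auto
      obtain j where j: "h x j < h m j" using below[OF m(2)] by blast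
      have "h x j < h y j" if y: "y \<in> H k" "(x, y) \<in> r" for y
      proof (cases "y = m")
        case False
        then have "(m, y) \<in> r" using min y m(1) sub r(3) unfolding total_on_def by blast
        then show ?thesis using le[OF m(1) y(1), of j] j by simp
      qed (use j in simp)
      then show ?thesis by blast
    qed
    define J where "J x = (SOME j. \<forall>y\<in>H k. (x, y) \<in> r \<longrightarrow> h x j < h y j)" for x
    have J: "h x (J x) < h y (J x)" if "x \<in> H k" "y \<in> H k" "(x, y) \<in> r" for x y
      using someI_ex[OF ex[OF that(1)]] that(2,3) unfolding J_def by blast
    \<comment> \<open>Two members with the same coordinate \<open>J\<close> and the same value there
      contradict strict growth at that coordinate.\<close>
    obtain jv where jv: "uncountable {x \<in> H k. (J x, h x (J x)) = jv}"
      using k by (rule uncountable_pigeonhole)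
    let ?W = "{x \<in> H k. (J x, h x (J x)) = jv}"
    obtain x where x: "x \<in> ?W" using jv by (metis countable_empty equals0I)
    have "\<not> ?W \<subseteq> {x}" using jv by (meson countable_finite finite.intros countable_subset)
    then obtain y where y: "y \<in> ?W" "y \<noteq> x" by blast
    have "(x, y) \<in> r \<or> (y, x) \<in> r" using r(3) x y sub unfolding total_on_def by blast
    then show False using J[of x y] J[of y x] x y by auto
  qed
qed

section \<open>The colouring of triples\<close>

type_synonym point = "(nat \<Rightarrow> bool) \<times> (nat \<Rightarrow> nat) \<times> (nat \<Rightarrow> nat)"

definition column :: "(nat \<Rightarrow> bool) \<Rightarrow> (bool list \<times> nat) set" where
  "column x = {(s, j). map x [0..<length s] = s}"

definition subgraph :: "(nat \<Rightarrow> bool) \<Rightarrow> (nat \<Rightarrow> nat) \<Rightarrow> (bool list \<times> nat) set" where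
  "subgraph x p = {(s, j). map x [0..<length s] = s \<and> j < p (length s)}"

text \<open>With the levels \<open>length s = n\<close> as vertical sections, this is the ideal Fin
  x {empty}.\<close>

definition few_levels :: "(bool list \<times> nat) set \<Rightarrow> bool" where
  "few_levels C \<longleftrightarrow> finite ((\<lambda>(s, j). length s) ` C)"

lemma few_levels_empty [simp]: "few_levels {}"
  by (simp add: few_levels_def)

lemma few_levels_mono: "few_levels D \<Longrightarrow> C \<subseteq> D \<Longrightarrow> few_levels C"
  unfolding few_levels_def by (meson finite_subset image_mono)

lemma few_levels_Un: "few_levels C \<Longrightarrow> few_levels D \<Longrightarrow> few_levels (C \<union> D)"
  unfolding few_levels_def by (simp add: image_Un)

text \<open>A lifting to sets of a lattice embedding into \<open>P(\<nat>)/Fin\<close>, onto the part below the image of the whole set.\<close>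

locale level_embedding =
  fixes \<Psi> :: "(bool list \<times> nat) set \<Rightarrow> nat set"
  assumes diff: "finite (\<Psi> C - \<Psi> D) \<longleftrightarrow> few_levels (C - D)"
    and inter: "finite (\<Psi> C \<inter> \<Psi> D - \<Psi> (C \<inter> D))"
    and onto: "B \<subseteq> \<Psi> C \<Longrightarrow> \<exists>C'. finite (sym_diff (\<Psi> C') B)"
begin

definition A :: "(nat \<Rightarrow> bool) \<Rightarrow> nat set" where
  "A x = \<Psi> (column x)"

definition G :: "(nat \<Rightarrow> bool) \<Rightarrow> (nat \<Rightarrow> nat) \<Rightarrow> nat set" where
  "G x p = \<Psi> (subgraph x p) \<inter> A x"

text \<open>As \<open>\<Psi>\<close> is only a lifting, \<open>p \<le> q\<close> gives \<open>G x p \<subseteq> G x q\<close> up to a finite set. Intersecting with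
  \<open>G x q\<close> makes the inclusion exact.\<close>

definition lo :: "point \<Rightarrow> nat set" where
  "lo = (\<lambda>(x, p, q). G x p \<inter> G x q)"

text \<open>The last clause says that no set can separate the two triples uniformly, by containing
  each \<open>lo\<close> and meeting each \<open>A\<close> inside the upper \<open>G\<close>. The
  middle clause keeps the subgraph of each \<open>p\<close> under the other upper function along the
  common stem, which is finite because \<open>x \<noteq> x'\<close>.\<close>

definition K :: "point \<Rightarrow> point \<Rightarrow> bool" where
  "K = (\<lambda>(x, p, q) (x', p', q'). x \<noteq> x' \<and>
     (\<forall>n. map x [0..<n] = map x' [0..<n] \<longrightarrow> p n \<le> q' n \<and> p' n \<le> q n) \<and>
     (\<not> lo (x, p, q) \<inter> A x' \<subseteq> G x' q' \<or> \<not> lo (x', p', q') \<inter> A x \<subseteq> G x q))"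

lemma Psi_mono: "C \<subseteq> D \<Longrightarrow> finite (\<Psi> C - \<Psi> D)"
  by (simp add: diff Diff_eq_empty_iff[THEN iffD2])

lemma K_sym: "K a b \<Longrightarrow> K b a"
  unfolding K_def case_prod_beta by metis

text \<open>\<open>\<Psi> C\<close> separates every triple of the clique up to a finite error.
  Uncountably many triples share the bound of the error and the part of \<open>lo\<close> below it,
  and no two of these can be joined by \<open>K\<close>.\<close>

lemma countable_clique:
  assumes Y: "\<forall>h\<in>Y. fst (snd h) \<le> snd (snd h)" and clique: "\<forall>a\<in>Y. \<forall>b\<in>Y. a \<noteq> b \<longrightarrow> K a b"
  shows "countable Y"
proof (rule ccontr)
  assume unc: "uncountable Y"
  define C where "C = (\<Union>h\<in>Y. subgraph (fst h) (fst (snd h)))"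
  \<comment> \<open>Outside \<open>E h\<close>, points of \<open>lo h\<close> lie in
    \<open>\<Psi> C\<close>, and points of \<open>\<Psi> C\<close> in \<open>A (fst h)\<close> lie
    in the upper \<open>G\<close>.\<close>
  define E where "E h = (\<Psi> (subgraph (fst h) (fst (snd h))) - \<Psi> C) \<union>
    (\<Psi> C \<inter> A (fst h) - \<Psi> (subgraph (fst h) (snd (snd h))))" for h
  have "\<exists>N. E h \<subseteq> {..<N}" if h: "h \<in> Y" for h
  proof -
    obtain x p q where hx: "h = (x, p, q)" by (cases h)
    have "subgraph x p \<subseteq> C" using h unfolding hx C_def by force
    from Psi_mono[OF this] have 1: "finite (\<Psi> (subgraph x p) - \<Psi> C)" .
    \<comment> \<open>A point of \<open>C\<close> in \<open>column x\<close> comes from a triple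
      whose real shares the stem \<open>s\<close> with \<open>x\<close>; there the middle clause of
      \<open>K\<close> bounds its function by \<open>q\<close>.\<close>
    have "C \<inter> column x \<subseteq> subgraph x q"
    proof
      fix sj assume sj: "sj \<in> C \<inter> column x"
      obtain s j where eq: "sj = (s, j)" by (cases sj)
      obtain h' where h': "h' \<in> Y" "(s, j) \<in> subgraph (fst h') (fst (snd h'))"
        using sj unfolding eq C_def by blast
      have s: "map x [0..<length s] = s" using sj by (simp add: eq column_def)
      have j: "map (fst h') [0..<length s] = s" "j < fst (snd h') (length s)"
        using h'(2) by (simp_all add: subgraph_def)
      have "fst (snd h') (length s) \<le> q (length s)"
      proof (cases "h' = h")
        case True
        then show ?thesis using Y h by (auto simp: hx le_fun_def)
      next
        case False
        then have "K h' h" using clique h h'(1) by blast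
        then have "\<forall>n. map (fst h') [0..<n] = map x [0..<n] \<longrightarrow> fst (snd h') n \<le> q n"
          unfolding K_def hx case_prod_beta by simp
        moreover have "map (fst h') [0..<length s] = map x [0..<length s]" unfolding s j(1) ..
        ultimately show ?thesis by blast
      qed
      then show "sj \<in> subgraph x q" using s j by (simp add: eq subgraph_def)
    qed
    from Psi_mono[OF this] have "finite (\<Psi> (C \<inter> column x) - \<Psi> (subgraph x q))" .
    moreover have "finite (\<Psi> C \<inter> \<Psi> (column x) - \<Psi> (C \<inter> column x))" by (rule inter)
    ultimately have "finite ((\<Psi> (C \<inter> column x) - \<Psi> (subgraph x q)) \<union>
        (\<Psi> C \<inter> \<Psi> (column x) - \<Psi> (C \<inter> column x)))" by (rule finite_UnI)
    then have "finite (\<Psi> C \<inter> \<Psi> (column x) - \<Psi> (subgraph x q))"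
      by (rule rev_finite_subset) blast
    with 1 have "finite (E h)" by (simp add: E_def hx A_def)
    then show ?thesis by (simp add: finite_nat_iff_bounded)
  qed
  then have "\<forall>h\<in>Y. \<exists>N. E h \<subseteq> {..<N}" by blast
  from bchoice[OF this] obtain N where N: "\<forall>h\<in>Y. E h \<subseteq> {..<N h}" by (rule exE)
  obtain c where c: "uncountable {h \<in> Y. (N h, map (\<lambda>m. m \<in> lo h) [0..<N h]) = c}"
    using unc by (rule uncountable_pigeonhole)
  let ?W = "{h \<in> Y. (N h, map (\<lambda>m. m \<in> lo h) [0..<N h]) = c}"
  have key: "lo h \<inter> A (fst h') \<subseteq> G (fst h') (snd (snd h'))" if h: "h \<in> ?W" "h' \<in> ?W" for h h'
  proof
    fix m assume m: "m \<in> lo h \<inter> A (fst h')"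
    have N_eq: "N h = N h'" and lo_eq: "map (\<lambda>m. m \<in> lo h) [0..<N h] = map (\<lambda>m. m \<in> lo h') [0..<N h]"
      using h by auto
    show "m \<in> G (fst h') (snd (snd h'))"
    proof (cases "m < N h")
      case True
      then have "m \<in> lo h'" using lo_eq m by (simp add: map_eq_conv)
      then show ?thesis by (simp add: lo_def case_prod_beta)
    next
      case False
      moreover have "E h \<subseteq> {..<N h}" "E h' \<subseteq> {..<N h'}" using N h by blast+
      ultimately have "m \<notin> E h" "m \<notin> E h'" using N_eq by auto
      then show ?thesis using m unfolding E_def lo_def G_def case_prod_beta by blast
    qed
  qed
  have "?W \<noteq> {}" using c by (metis countable_empty)
  then obtain a where a: "a \<in> ?W" by blast
  have "\<not> ?W \<subseteq> {a}"
  proof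
    assume "?W \<subseteq> {a}"
    then have "countable ?W" by (rule countable_subset) simp
    with c show False by contradiction
  qed
  then obtain b where b: "b \<in> ?W" "b \<noteq> a" by blast
  have "K a b" using clique a b by simp
  then show False using key[OF a b(1)] key[OF b(1) a] unfolding K_def case_prod_beta by simp
qed

text \<open>The membership tests refine the product topology on triples, since nothing is known
  about continuity of \<open>G\<close> and \<open>A\<close>.\<close>

definition test :: "point \<Rightarrow> nat \<times> nat \<times> nat \<Rightarrow> bool" where
  "test h = (\<lambda>(t, i, j). if t = 0 then fst h i
    else if t = 1 then fst (snd h) i = j else if t = 2 then snd (snd h) i = j
    else if t = 3 then i \<in> G (fst h) (fst (snd h)) else if t = 4 then i \<in> G (fst h) (snd (snd h))
    else i \<in> A (fst h))"

text \<open>Once \<open>x\<close> and \<open>y\<close> differ at \<open>i\<close>, common stems have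
  length at most \<open>i\<close>, and the last clause of \<open>K\<close> is witnessed by a single
  \<open>m\<close>. So finitely many tests suffice.\<close>

lemma K_open:
  assumes "K a b"
  shows "\<exists>F. finite F \<and> (\<forall>a' b'. (\<forall>t\<in>F. test a' t = test a t) \<longrightarrow> (\<forall>t\<in>F. test b' t = test b t) \<longrightarrow> K a' b')"
proof -
  obtain x p q where a: "a = (x, p, q)" by (cases a)
  obtain y r s where b: "b = (y, r, s)" by (cases b)
  obtain i where i: "x i \<noteq> y i" using assms(1) unfolding K_def a b by auto
  have coh: "p n \<le> s n \<and> r n \<le> q n" if "map x [0..<n] = map y [0..<n]" for n
    using assms(1) that unfolding K_def a b by simp
  obtain m where m: "m \<in> lo a \<inter> A y - G y s \<or> m \<in> lo b \<inter> A x - G x q"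
    using assms(1) unfolding K_def a b by auto
  define I where "I = insert m {..i}"
  \<comment> \<open>The value \<open>0\<close> fills the third component of the tests that ignore
    it.\<close>
  define J where "J = insert 0 (p ` I \<union> q ` I \<union> r ` I \<union> s ` I)"
  define F where "F = {..5::nat} \<times> I \<times> J"
  have "finite F" by (simp add: F_def I_def J_def)
  moreover have "K a' b'" if a': "\<forall>t\<in>F. test a' t = test a t" and b': "\<forall>t\<in>F. test b' t = test b t" for a' b'
  proof -
    obtain x' p' q' where a'eq: "a' = (x', p', q')" by (cases a')
    obtain y' r' s' where b'eq: "b' = (y', r', s')" by (cases b')
    have in_F: "(t, n, j) \<in> F" if "t \<le> 5" "n \<in> I" "j \<in> J" for t n j
      using that by (simp add: F_def)
    have J: "0 \<in> J" "n \<in> I \<Longrightarrow> p n \<in> J" "n \<in> I \<Longrightarrow> q n \<in> J" "n \<in> I \<Longrightarrow> r n \<in> J" "n \<in> I \<Longrightarrow> s n \<in> J" for n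
      by (auto simp: J_def)
    have x: "x' n = x n" "y' n = y n" if "n \<in> I" for n
      using a'[rule_format, OF in_F[of 0 n 0]] b'[rule_format, OF in_F[of 0 n 0]] that J(1)
      by (simp_all add: test_def a b a'eq b'eq)
    have p: "p' n = p n" "q' n = q n" "r' n = r n" "s' n = s n" if "n \<in> I" for n
      using a'[rule_format, OF in_F[of 1 n "p n"]] a'[rule_format, OF in_F[of 2 n "q n"]]
        b'[rule_format, OF in_F[of 1 n "r n"]] b'[rule_format, OF in_F[of 2 n "s n"]] that J(2-5)[OF that]
      by (simp_all add: test_def a b a'eq b'eq)
    have mI: "m \<in> I" by (simp add: I_def)
    have G: "m \<in> G x' p' \<longleftrightarrow> m \<in> G x p" "m \<in> G x' q' \<longleftrightarrow> m \<in> G x q" "m \<in> A x' \<longleftrightarrow> m \<in> A x"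
      "m \<in> G y' r' \<longleftrightarrow> m \<in> G y r" "m \<in> G y' s' \<longleftrightarrow> m \<in> G y s" "m \<in> A y' \<longleftrightarrow> m \<in> A y"
      using a'[rule_format, OF in_F[of 3 m 0]] a'[rule_format, OF in_F[of 4 m 0]]
        a'[rule_format, OF in_F[of 5 m 0]] b'[rule_format, OF in_F[of 3 m 0]]
        b'[rule_format, OF in_F[of 4 m 0]] b'[rule_format, OF in_F[of 5 m 0]] mI J(1)
      by (simp_all add: test_def a b a'eq b'eq)
    have iI: "n \<in> I" if "n \<le> i" for n using that by (simp add: I_def)
    have "x' \<noteq> y'" using i x[OF iI[OF order_refl]] by auto
    moreover have "p' n \<le> s' n \<and> r' n \<le> q' n" if eq: "map x' [0..<n] = map y' [0..<n]" for n
    proof -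
      have *: "x' k = y' k" if "k < n" for k
        using eq that by (simp add: map_eq_conv)
      have "n \<le> i" using *[of i] i x[OF iI[OF order_refl]] by (meson not_le)
      then have "x k = y k" if "k < n" for k
        using *[OF that] x[OF iI[of k]] that by simp
      then have "map x [0..<n] = map y [0..<n]" by simp
      from coh[OF this] show ?thesis using p[OF iI[OF \<open>n \<le> i\<close>]] by simp
    qed
    moreover have "m \<in> lo a' \<inter> A y' - G y' s' \<or> m \<in> lo b' \<inter> A x' - G x' q'"
      using m G unfolding lo_def a b a'eq b'eq by simp
    ultimately show "K a' b'" unfolding K_def a'eq b'eq by auto
  qed
  ultimately show ?thesis by blast
qed

lemma OCA_cover:
  assumes OCA
  obtains H :: "nat \<Rightarrow> point set" where
    "{h. fst (snd h) \<le> snd (snd h)} = (\<Union>k. H k)" "\<forall>k. \<forall>a\<in>H k. \<forall>b\<in>H k. \<not> K a b"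
proof -
  let ?X = "{h :: point. fst (snd h) \<le> snd (snd h)}"
  have "(\<exists>Y\<subseteq>?X. uncountable Y \<and> (\<forall>a\<in>Y. \<forall>b\<in>Y. a \<noteq> b \<longrightarrow> K a b)) \<or>
    (\<exists>H :: nat \<Rightarrow> point set. ?X = (\<Union>k. H k) \<and> (\<forall>k. \<forall>a\<in>H k. \<forall>b\<in>H k. \<not> K a b))"
  proof (rule OCA_tests[OF assms, where c = test])
    show "inj_on test ?X"
    proof (rule inj_onI)
      fix a b :: point assume "test a = test b"
      then have *: "test a t = test b t" for t by simp
      have "fst a i = fst b i" for i using *[of "(0, i, 0)"] by (simp add: test_def)
      moreover have "fst (snd a) i = fst (snd b) i" for i
        using *[of "(1, i, fst (snd a) i)"] by (simp add: test_def)
      moreover have "snd (snd a) i = snd (snd b) i" for i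
        using *[of "(2, i, snd (snd a) i)"] by (simp add: test_def)
      ultimately show "a = b" by (intro prod_eqI ext) simp_all
    qed
    show "K b a" if "K a b" for a b using that by (rule K_sym)
    show "\<not> K a a" for a by (simp add: K_def case_prod_beta)
    fix a b assume "K a b"
    from K_open[OF this] obtain F where "finite F"
      "\<forall>a' b'. (\<forall>t\<in>F. test a' t = test a t) \<longrightarrow> (\<forall>t\<in>F. test b' t = test b t) \<longrightarrow> K a' b'"
      by (elim exE conjE)
    then show "\<exists>F. finite F \<and> (\<forall>a'\<in>?X. \<forall>b'\<in>?X.
        (\<forall>t\<in>F. test a' t = test a t) \<longrightarrow> (\<forall>t\<in>F. test b' t = test b t) \<longrightarrow> K a' b')" by (intro exI[of _ F]) simp
  qed
  then have "\<exists>H :: nat \<Rightarrow> point set. ?X = (\<Union>k. H k) \<and> (\<forall>k. \<forall>a\<in>H k. \<forall>b\<in>H k. \<not> K a b)"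
  proof (elim disjE exE conjE)
    fix Y assume "Y \<subseteq> ?X" "uncountable Y" "\<forall>a\<in>Y. \<forall>b\<in>Y. a \<noteq> b \<longrightarrow> K a b"
    moreover from this(1) have "\<forall>h\<in>Y. fst (snd h) \<le> snd (snd h)" by blast
    ultimately show ?thesis using countable_clique by simp
  qed (intro exI conjI; assumption)
  then show ?thesis using that by (elim exE conjE)
qed

end

section \<open>OCA excludes level embeddings\<close>

definition ev_le :: "(nat \<Rightarrow> nat) \<Rightarrow> (nat \<Rightarrow> nat) \<Rightarrow> bool" where
  "ev_le f g \<longleftrightarrow> (\<exists>n. \<forall>j\<ge>n. f j \<le> g j)"

definition dominating :: "(nat \<Rightarrow> nat) set \<Rightarrow> bool" where
  "dominating P \<longleftrightarrow> (\<forall>f. \<exists>p\<in>P. ev_le f p)"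

lemma dominating_mono: "dominating P \<Longrightarrow> P \<subseteq> Q \<Longrightarrow> dominating Q"
  unfolding dominating_def by blast

lemma dominating_UN:
  fixes P :: "nat \<Rightarrow> (nat \<Rightarrow> nat) set"
  assumes "dominating (\<Union>i. P i)"
  shows "\<exists>i. dominating (P i)"
proof (rule ccontr)
  assume "\<not> ?thesis"
  then have "\<forall>i. \<exists>f. \<forall>p\<in>P i. \<not> ev_le f p" unfolding dominating_def by blast
  from choice[OF this] obtain f where f: "\<forall>i. \<forall>p\<in>P i. \<not> ev_le (f i) p" by (rule exE)
  define g where "g j = (\<Sum>i\<le>j. f i j)" for j
  obtain p where p: "p \<in> (\<Union>i. P i)" "ev_le g p" using assms unfolding dominating_def by blast
  then obtain i where i: "p \<in> P i" by blast
  obtain n where n: "\<forall>j\<ge>n. g j \<le> p j" using p(2) by (auto simp: ev_le_def)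
  have "f i j \<le> p j" if "j \<ge> max n i" for j
  proof -
    have "f i j \<le> g j" unfolding g_def using that by (intro member_le_sum) auto
    then show ?thesis using n that by (meson max.boundedE order_trans)
  qed
  then have "ev_le (f i) p" unfolding ev_le_def by blast
  then show False using f i by blast
qed

fun prefix_rec :: "('a list \<Rightarrow> 'a) \<Rightarrow> nat \<Rightarrow> 'a list" where
  "prefix_rec w 0 = []"
| "prefix_rec w (Suc n) = prefix_rec w n @ [w (prefix_rec w n)]"

lemma ex_course_of_values:
  fixes w :: "'a list \<Rightarrow> 'a"
  shows "\<exists>q. \<forall>n :: nat. q n = w (map q [0..<n])"
proof (intro exI allI)
  define q where "q n = w (prefix_rec w n)" for n
  have "map q [0..<n] = prefix_rec w n" for n
    by (induction n) (simp_all add: q_def)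
  then show "w (prefix_rec w n) = w (map (\<lambda>n. w (prefix_rec w n)) [0..<n])" for n
    by (simp add: q_def[abs_def])
qed

lemma uncountable_UNIV_nat_bool: "uncountable (UNIV :: (nat \<Rightarrow> bool) set)"
proof
  assume "countable (UNIV :: (nat \<Rightarrow> bool) set)"
  then have "countable (range (Collect :: (nat \<Rightarrow> bool) \<Rightarrow> nat set))" by (rule countable_image)
  moreover have "range Collect = (UNIV :: nat set set)"
    by (metis Collect_mem_eq surjI)
  ultimately have "countable (UNIV :: real set)"
    using countable_eqpoll eqpoll_sym[OF nat_sets_eqpoll_reals] by metis
  then show False using uncountable_UNIV_real by blast
qed

context level_embedding
begin

lemma G_subset_A: "G x p \<subseteq> A x"
  by (simp add: G_def)

text \<open>At every level the point of the column at height \<open>p n\<close> lies just above the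
  subgraph.\<close>

lemma infinite_A_Diff_G: "infinite (A x - G x p)"
proof -
  have "UNIV \<subseteq> (\<lambda>(s, j). length s) ` (column x - subgraph x p)"
  proof
    fix n :: nat
    have "(map x [0..<n], p n) \<in> column x - subgraph x p"
      by (simp add: column_def subgraph_def)
    then show "n \<in> (\<lambda>(s, j). length s) ` (column x - subgraph x p)"
      by (rule rev_image_eqI) simp
  qed
  then have "\<not> few_levels (column x - subgraph x p)"
    unfolding few_levels_def using finite_subset infinite_UNIV_nat by blast
  then have "infinite (\<Psi> (column x) - \<Psi> (subgraph x p))" by (simp add: diff)
  moreover have "A x - G x p = \<Psi> (column x) - \<Psi> (subgraph x p)" by (auto simp: A_def G_def)
  ultimately show ?thesis by simp
qed

lemma finite_Psi_iff: "finite (\<Psi> C) \<longleftrightarrow> few_levels C"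
proof -
  obtain D where "finite (sym_diff (\<Psi> D) {})" using onto[of "{}" "{}"] by blast
  then have "finite (\<Psi> D)" by simp
  moreover have "finite (\<Psi> {} - \<Psi> D)" by (rule Psi_mono) simp
  ultimately have "finite (\<Psi> {})" by (meson finite_Diff2)
  then have "finite (\<Psi> C) \<longleftrightarrow> finite (\<Psi> C - \<Psi> {})" by (simp add: finite_Diff2)
  then show ?thesis by (simp add: diff)
qed

text \<open>By \<open>onto\<close>, \<open>B\<close> corresponds to a set \<open>C\<close> meeting
  \<open>column x\<close> at infinitely many levels. A member of \<open>P\<close> eventually above
  the least such heights catches a point at almost all of these levels.\<close>

lemma dominating_imp_infinite_Int_G:
  assumes B: "B \<subseteq> A x" "infinite B" and P: "dominating P"
  shows "\<exists>p\<in>P. infinite (B \<inter> G x p)"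
proof -
  obtain C where C: "finite (sym_diff (\<Psi> C) B)" using onto B(1) unfolding A_def by blast
  then have fin: "finite (\<Psi> C - B)" "finite (B - \<Psi> C)" by auto
  have "infinite (\<Psi> C)" using fin(2) B(2) by (meson finite_Diff2)
  then have "\<not> few_levels C" by (simp add: finite_Psi_iff)
  moreover have "few_levels (C - column x)"
  proof -
    have "finite (\<Psi> C - \<Psi> (column x))"
      by (rule finite_subset[OF _ fin(1)]) (use B(1) in \<open>auto simp: A_def\<close>)
    then show ?thesis by (simp add: diff)
  qed
  ultimately have notfew: "\<not> few_levels (C \<inter> column x)"
    using few_levels_Un[of "C \<inter> column x" "C - column x"] by (metis Int_Diff_Un)
  \<comment> \<open>\<open>Suc\<close> fits the strict inequality in \<open>subgraph\<close>; levels
    without a point of \<open>C\<close> in the column get an arbitrary value.\<close>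
  define f where "f n = Suc (LEAST j. (map x [0..<n], j) \<in> C)" for n
  obtain p n where p: "p \<in> P" "\<forall>j\<ge>n. f j \<le> p j" using P unfolding dominating_def ev_le_def by blast
  have "(\<lambda>(s, j). length s) ` (C \<inter> column x) \<subseteq> {..<n} \<union> (\<lambda>(s, j). length s) ` (C \<inter> subgraph x p)"
  proof clarify
    fix s j assume sj: "(s, j) \<in> C" "(s, j) \<in> column x" "length s \<notin> (\<lambda>(s, j). length s) ` (C \<inter> subgraph x p)"
    show "length s < n"
    proof (rule ccontr)
      assume "\<not> length s < n"
      let ?j = "LEAST j. (s, j) \<in> C"
      have s: "map x [0..<length s] = s" using sj(2) by (simp add: column_def)
      have "(s, ?j) \<in> C" using sj(1) by (rule LeastI)
      moreover have "?j < p (length s)"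
        using p(2)[rule_format, of "length s"] \<open>\<not> length s < n\<close> by (simp add: f_def s)
      ultimately have "(s, ?j) \<in> C \<inter> subgraph x p" by (simp add: subgraph_def s)
      then have "length s \<in> (\<lambda>(s, j). length s) ` (C \<inter> subgraph x p)" by (rule rev_image_eqI) simp
      with sj(3) show False by contradiction
    qed
  qed
  then have "\<not> few_levels (C \<inter> subgraph x p)"
    using notfew unfolding few_levels_def by (meson finite_UnI finite_lessThan finite_subset)
  then have inf: "infinite (\<Psi> (C \<inter> subgraph x p))" by (simp add: finite_Psi_iff)
  have "finite (\<Psi> (C \<inter> subgraph x p) - \<Psi> C)" "finite (\<Psi> (C \<inter> subgraph x p) - \<Psi> (subgraph x p))"
    "finite (\<Psi> (C \<inter> subgraph x p) - A x)"
    unfolding A_def by (rule Psi_mono; auto simp: subgraph_def column_def)+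
  with fin(1) have "finite ((\<Psi> C - B) \<union> (\<Psi> (C \<inter> subgraph x p) - \<Psi> C) \<union>
      (\<Psi> (C \<inter> subgraph x p) - \<Psi> (subgraph x p)) \<union> (\<Psi> (C \<inter> subgraph x p) - A x))"
    by simp
  then have "finite (\<Psi> (C \<inter> subgraph x p) - B \<inter> G x p)"
    by (rule rev_finite_subset) (auto simp: G_def)
  with inf have "infinite (B \<inter> G x p)" by (meson finite_Diff2)
  with p(1) show ?thesis by blast
qed

text \<open>For fixed \<open>k\<close> and \<open>m\<close>, the triples in \<open>Bad k m\<close> determine \<open>x\<close> from \<open>(p, q)\<close>. If no \<open>x\<close> were
  generic, then bounding \<open>\<aleph>\<^sub>1\<close> many witnesses would produce one pair \<open>(p, q)\<close> that is bad for
  uncountably many \<open>x\<close>, hence for two of them with the same \<open>k\<close> and \<open>m\<close>.\<close>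

lemma OCA_generic:
  fixes H :: "nat \<Rightarrow> point set"
  assumes OCA: OCA
  defines "Bad \<equiv> \<lambda>k m. {h \<in> H k. m \<in> lo h \<and> \<not> (\<exists>d\<in>H k. fst d \<noteq> fst h \<and> m \<in> lo d \<and>
      (\<forall>n. map (fst d) [0..<n] = map (fst h) [0..<n] \<longrightarrow>
        fst (snd d) n = fst (snd h) n \<and> snd (snd d) n = snd (snd h) n))}"
  shows "\<exists>x. dominating {p. strongly_dominating {q. p \<le> q \<and> (\<forall>k m. (x, p, q) \<notin> Bad k m)}}"
proof (rule ccontr)
  assume "\<not> ?thesis"
  then have "\<forall>x. \<exists>f. \<forall>p. ev_le f p \<longrightarrow>
      \<not> strongly_dominating {q. p \<le> q \<and> (\<forall>k m. (x, p, q) \<notin> Bad k m)}"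
    unfolding dominating_def by blast
  from choice[OF this] obtain f where f: "\<forall>x p. ev_le (f x) p \<longrightarrow>
      \<not> strongly_dominating {q. p \<le> q \<and> (\<forall>k m. (x, p, q) \<notin> Bad k m)}"
    by (rule exE)
  obtain Z p where Z: "uncountable Z" "\<forall>x\<in>Z. ev_le (f x) p"
    using OCA_bounding[OF OCA uncountable_UNIV_nat_bool, of f] unfolding ev_le_def by blast
  \<comment> \<open>With the common bound \<open>p\<close>, every \<open>x\<close> in
    \<open>Z\<close> has a rule \<open>\<phi>\<close> such that all \<open>q \<ge> p\<close> obeying
    it eventually are bad.\<close>
  have "\<forall>x\<in>Z. \<exists>\<phi>. \<forall>q. p \<le> q \<longrightarrow> (\<exists>n. \<forall>j\<ge>n. \<phi> (map q [0..<j]) \<le> q j) \<longrightarrow> (\<exists>k m. (x, p, q) \<in> Bad k m)"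
  proof
    fix x assume "x \<in> Z"
    then have "\<not> strongly_dominating {q. p \<le> q \<and> (\<forall>k m. (x, p, q) \<notin> Bad k m)}"
      using f Z(2) by blast
    then obtain \<phi> where "\<forall>q\<in>{q. p \<le> q \<and> (\<forall>k m. (x, p, q) \<notin> Bad k m)}.
        \<not> (\<exists>n. \<forall>j\<ge>n. \<phi> (map q [0..<j]) \<le> q j)"
      unfolding strongly_dominating_def by blast
    then have "\<forall>q. p \<le> q \<longrightarrow> (\<exists>n. \<forall>j\<ge>n. \<phi> (map q [0..<j]) \<le> q j) \<longrightarrow> (\<exists>k m. (x, p, q) \<in> Bad k m)"
      by blast
    then show "\<exists>\<phi>. \<forall>q. p \<le> q \<longrightarrow> (\<exists>n. \<forall>j\<ge>n. \<phi> (map q [0..<j]) \<le> q j) \<longrightarrow>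
        (\<exists>k m. (x, p, q) \<in> Bad k m)" by (intro exI[of _ \<phi>])
  qed
  from bchoice[OF this] obtain \<phi> where \<phi>: "\<forall>x\<in>Z. \<forall>q. p \<le> q \<longrightarrow>
      (\<exists>n. \<forall>j\<ge>n. \<phi> x (map q [0..<j]) \<le> q j) \<longrightarrow> (\<exists>k m. (x, p, q) \<in> Bad k m)"
    by (rule exE)
  \<comment> \<open>The rules are functions on a countable set of stems, so uncountably many of them
    can be bounded together.\<close>
  obtain Z' g where Z': "Z' \<subseteq> Z" "uncountable Z'" "\<forall>x\<in>Z'. \<exists>n. \<forall>i\<ge>n. \<phi> x (from_nat i) \<le> g i"
    using OCA_bounding[OF OCA Z(1), of "\<lambda>x i. \<phi> x (from_nat i)"] by blast
  \<comment> \<open>\<open>q\<close> obeys \<open>g\<close> at the code of its own past. These codes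
    are distinct, so only finitely many fall into the exceptional range of a given
    \<open>\<phi> x\<close>.\<close>
  obtain q where q: "\<And>n. q n = max (p n) (g (to_nat (map q [0..<n])))"
    using ex_course_of_values[of "\<lambda>l. max (p (length l)) (g (to_nat l))"] by auto
  have "p \<le> q" by (rule le_funI) (metis q max.cobounded1)
  have inj: "inj (\<lambda>j. to_nat (map q [0..<j]))"
    by (rule injI) (metis diff_zero from_nat_to_nat length_map length_upt)
  have "\<exists>k m. (x, p, q) \<in> Bad k m" if x: "x \<in> Z'" for x
  proof -
    obtain n where n: "\<forall>i\<ge>n. \<phi> x (from_nat i) \<le> g i" using Z'(3) x by blast
    have "finite ((\<lambda>j. to_nat (map q [0..<j])) -` {..<n})"
      using inj by (intro finite_vimageI) auto
    then obtain N where N: "(\<lambda>j. to_nat (map q [0..<j])) -` {..<n} \<subseteq> {..<N}"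
      using finite_nat_iff_bounded by blast
    have "\<phi> x (map q [0..<j]) \<le> q j" if "j \<ge> N" for j
    proof -
      have "\<not> to_nat (map q [0..<j]) < n" using N that by auto
      then have "\<phi> x (map q [0..<j]) \<le> g (to_nat (map q [0..<j]))"
        using n[rule_format, of "to_nat (map q [0..<j])"] by simp
      also have "\<dots> \<le> q j" by (subst q) simp
      finally show ?thesis .
    qed
    then show ?thesis using \<phi> x Z'(1) \<open>p \<le> q\<close> by blast
  qed
  then have "\<forall>x\<in>Z'. \<exists>km. (x, p, q) \<in> Bad (fst km) (snd km)" by fastforce
  from bchoice[OF this] obtain c where c: "\<forall>x\<in>Z'. (x, p, q) \<in> Bad (fst (c x)) (snd (c x))"
    by (rule exE)
  obtain km where km: "uncountable {x \<in> Z'. c x = km}" using Z'(2) by (rule uncountable_pigeonhole)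
  obtain x where x: "x \<in> {x \<in> Z'. c x = km}" using km by (metis countable_empty equals0I)
  have "\<not> {x \<in> Z'. c x = km} \<subseteq> {x}"
  proof
    assume "{x \<in> Z'. c x = km} \<subseteq> {x}"
    then have "countable {x \<in> Z'. c x = km}" by (rule countable_subset) simp
    with km show False by contradiction
  qed
  then obtain y where y: "y \<in> {x \<in> Z'. c x = km}" "y \<noteq> x" by blast
  have "(x, p, q) \<in> Bad (fst km) (snd km)" "(y, p, q) \<in> Bad (fst km) (snd km)"
    using c x y(1) by auto
  \<comment> \<open>Both triples lie in one piece, have the same \<open>m\<close> in
    \<open>lo\<close> and carry the same functions, so each is the \<open>d\<close> denied to the
    other.\<close>
  then show False using y(2) unfolding Bad_def by force
qed

end

section \<open>The contradiction at a generic real\<close>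

lemma strongly_dominating_mono:
  assumes "strongly_dominating P" "P \<subseteq> Q"
  shows "strongly_dominating Q"
  unfolding strongly_dominating_def
proof
  fix \<phi> :: "nat list \<Rightarrow> nat"
  obtain q where "q \<in> P" "\<exists>n. \<forall>j\<ge>n. \<phi> (map q [0..<j]) \<le> q j"
    using assms(1) unfolding strongly_dominating_def by blast
  then show "\<exists>q\<in>Q. \<exists>n. \<forall>j\<ge>n. \<phi> (map q [0..<j]) \<le> q j" using assms(2) by blast
qed

context level_embedding
begin

lemma not_OCA: "\<not> OCA"
proof
  assume OCA: OCA
  obtain H :: "nat \<Rightarrow> point set" where cover: "{h. fst (snd h) \<le> snd (snd h)} = (\<Union>k. H k)"
    and noK: "\<forall>k. \<forall>a\<in>H k. \<forall>b\<in>H k. \<not> K a b"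
    by (rule OCA_cover[OF OCA])
  define Bad where "Bad = (\<lambda>k m. {h \<in> H k. m \<in> lo h \<and> \<not> (\<exists>d\<in>H k. fst d \<noteq> fst h \<and> m \<in> lo d \<and>
      (\<forall>n. map (fst d) [0..<n] = map (fst h) [0..<n] \<longrightarrow>
        fst (snd d) n = fst (snd h) n \<and> snd (snd d) n = snd (snd h) n))})"
  obtain x where x: "dominating {p. strongly_dominating {q. p \<le> q \<and> (\<forall>k m. (x, p, q) \<notin> Bad k m)}}"
    using OCA_generic[OF OCA, of H] unfolding Bad_def by (rule exE)
  define R where "R k N p = {q. p \<le> q \<and> (\<forall>k m. (x, p, q) \<notin> Bad k m) \<and> (x, p, q) \<in> H k \<and>
      G x p - G x q \<subseteq> {..<N}}" for k and N :: nat and p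
  \<comment> \<open>The parameters fix the piece \<open>k\<close>, the error bound \<open>N\<close>,
    and the stems \<open>s\<close> of \<open>q\<close> and \<open>u\<close> of \<open>p\<close>.
    There are countably many choices, so one of these sets is dominating.\<close>
  define full where "full = (\<lambda>(k, N, s, u). {p. map p [0..<length s] = u \<and>
      (\<forall>f. \<exists>q\<in>R k N p. map q [0..<length s] = s \<and> (\<forall>j\<ge>length s. f j \<le> q j))})"
  have "p \<in> (\<Union>i. full (from_nat i))"
    if p: "strongly_dominating {q. p \<le> q \<and> (\<forall>k m. (x, p, q) \<notin> Bad k m)}" for p
  proof -
    have "{q. p \<le> q \<and> (\<forall>k m. (x, p, q) \<notin> Bad k m)} \<subseteq>
        (\<Union>i. R (fst (prod_decode i)) (snd (prod_decode i)) p)"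
    proof
      fix q assume q: "q \<in> {q. p \<le> q \<and> (\<forall>k m. (x, p, q) \<notin> Bad k m)}"
      then have "(x, p, q) \<in> {h. fst (snd h) \<le> snd (snd h)}" by simp
      then obtain k where k: "(x, p, q) \<in> H k" unfolding cover by blast
      have "few_levels (subgraph x p - subgraph x q)"
        using q by (intro few_levels_mono[OF few_levels_empty]) (auto simp: subgraph_def le_fun_def intro: less_le_trans)
      then have "finite (\<Psi> (subgraph x p) - \<Psi> (subgraph x q))" by (simp add: diff)
      then have "finite (G x p - G x q)" by (rule rev_finite_subset) (auto simp: G_def)
      then obtain N where "G x p - G x q \<subseteq> {..<N}" using finite_nat_iff_bounded by blast
      then have "q \<in> R (fst (prod_decode (prod_encode (k, N)))) (snd (prod_decode (prod_encode (k, N)))) p"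
        using q k by (simp add: R_def)
      then show "q \<in> (\<Union>i. R (fst (prod_decode i)) (snd (prod_decode i)) p)" by blast
    qed
    with p have "strongly_dominating (\<Union>i. R (fst (prod_decode i)) (snd (prod_decode i)) p)"
      by (rule strongly_dominating_mono)
    from strongly_dominating_UN[OF this] obtain k N where "strongly_dominating (R k N p)"
      by (elim exE)
    from strongly_dominating_stem[OF this] obtain s where s: "\<forall>\<phi> :: nat list \<Rightarrow> nat.
        \<exists>q\<in>R k N p. map q [0..<length s] = s \<and> (\<forall>j\<ge>length s. \<phi> (map q [0..<j]) \<le> q j)"
      by (rule exE)
    have "\<exists>q\<in>R k N p. map q [0..<length s] = s \<and> (\<forall>j\<ge>length s. f j \<le> q j)" for f
      using s[rule_format, of "\<lambda>l. f (length l)"] by simp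
    then have "p \<in> full (from_nat (to_nat (k, N, s, map p [0..<length s])))"
      by (simp add: full_def)
    then show ?thesis by blast
  qed
  then have "dominating (\<Union>i. full (from_nat i))" by (intro dominating_mono[OF x]) blast
  from dominating_UN[OF this] obtain i where i: "dominating (full (from_nat i))" by (rule exE)
  obtain k N s u where "(from_nat i :: nat \<times> nat \<times> nat list \<times> nat list) = (k, N, s, u)"
    by (rule prod_cases4)
  with i have cof: "dominating (full (k, N, s, u))" by simp
  let ?P = "full (k, N, s, u)"
  \<comment> \<open>\<open>v\<close> bounds the first values of \<open>p\<close>, and
    \<open>W v\<close> is the part of \<open>A x\<close> beyond \<open>N\<close> that such
    \<open>p\<close> still reach.\<close>
  define P where "P v = {p \<in> ?P. \<forall>j<length v. p j \<le> v ! j}" for v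
  define W where "W v = (\<Union>p\<in>P v. G x p - {..<N})" for v
  have W_A: "W v \<subseteq> A x" for v using G_subset_A by (auto simp: W_def)
  have W_cofinite: "finite (A x - W v)" if "dominating (P v)" for v
  proof (rule ccontr)
    assume "infinite (A x - W v)"
    then obtain p where p: "p \<in> P v" "infinite ((A x - W v) \<inter> G x p)"
      using dominating_imp_infinite_Int_G[of "A x - W v" x "P v"] \<open>dominating (P v)\<close> by blast
    have "(A x - W v) \<inter> G x p \<subseteq> {..<N}" using p(1) by (auto simp: W_def)
    then show False using p(2) finite_subset finite_lessThan by blast
  qed
  \<comment> \<open>Some bound \<open>i0\<close> keeps the family dominating and loses at most
    finitely many points of \<open>W v\<close>. Raising the bound recovers each lost point, so
    \<open>W\<close> does not change at all.\<close>
  have step: "\<exists>i. dominating (P (v @ [i])) \<and> W (v @ [i]) = W v" if cof_v: "dominating (P v)" for v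
  proof -
    have P_snoc: "P (v @ [i]) = {p \<in> P v. p (length v) \<le> i}" for i
      by (auto simp: P_def nth_append less_Suc_eq)
    have "P v = (\<Union>i. P (v @ [i]))" unfolding P_snoc by blast
    then obtain i0 where i0: "dominating (P (v @ [i0]))" using dominating_UN cof_v by metis
    let ?D = "W v - W (v @ [i0])"
    have "finite ?D"
      using W_cofinite[OF i0] by (rule rev_finite_subset) (use W_A in blast)
    have "\<forall>m\<in>?D. \<exists>i. m \<in> W (v @ [i])"
    proof
      fix m assume "m \<in> ?D"
      then obtain p where p: "p \<in> P v" "m \<in> G x p - {..<N}" by (auto simp: W_def)
      then have "p \<in> P (v @ [p (length v)])" by (simp add: P_snoc)
      then have "m \<in> W (v @ [p (length v)])" using p(2) unfolding W_def by blast
      then show "\<exists>i. m \<in> W (v @ [i])" by (rule exI)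
    qed
    from bchoice[OF this] obtain I where I: "\<forall>m\<in>?D. m \<in> W (v @ [I m])" by (rule exE)
    define i where "i = Max (insert i0 (I ` ?D))"
    have ge: "i0 \<le> i" "m \<in> ?D \<Longrightarrow> I m \<le> i" for m
      using \<open>finite ?D\<close> by (simp_all add: i_def)
    have P_mono: "P (v @ [j]) \<subseteq> P (v @ [j'])" if "j \<le> j'" for j j'
      using that by (auto simp: P_snoc)
    then have W_mono: "W (v @ [j]) \<subseteq> W (v @ [j'])" if "j \<le> j'" for j j'
      unfolding W_def using that by blast
    have "dominating (P (v @ [i]))" by (rule dominating_mono[OF i0 P_mono[OF ge(1)]])
    moreover have "W v \<subseteq> W (v @ [i])"
    proof
      fix m assume m: "m \<in> W v"
      show "m \<in> W (v @ [i])"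
      proof (cases "m \<in> W (v @ [i0])")
        case True
        then show ?thesis using W_mono[OF ge(1)] by blast
      next
        case False
        then have "m \<in> ?D" using m by blast
        then show ?thesis using I W_mono[OF ge(2)] by blast
      qed
    qed
    moreover have "W (v @ [i]) \<subseteq> W v" unfolding W_def P_snoc by blast
    ultimately show ?thesis by blast
  qed
  define w where "w v = (SOME i. dominating (P (v @ [i])) \<and> W (v @ [i]) = W v)" for v
  have w: "dominating (P (v @ [w v])) \<and> W (v @ [w v]) = W v" if "dominating (P v)" for v
    unfolding w_def by (rule someI_ex[OF step[OF that]])
  obtain b where b: "\<forall>n. b n = w (map b [0..<n])"
    using ex_course_of_values[of w] by (rule exE)
  have P_Nil: "P [] = ?P" by (simp add: P_def)
  have inv: "dominating (P (map b [0..<n])) \<and> W (map b [0..<n]) = W []" for n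
  proof (induction n)
    case 0
    then show ?case using cof by (simp add: P_Nil)
  next
    case (Suc n)
    then have "dominating (P (map b [0..<n] @ [w (map b [0..<n])])) \<and>
        W (map b [0..<n] @ [w (map b [0..<n])]) = W []"
      using w[of "map b [0..<n]"] by simp
    then show ?case using b[rule_format, of n, symmetric] by simp
  qed
  \<comment> \<open>Each \<open>m\<close> receives a function \<open>p m\<close> that
    \<open>b\<close> bounds on the coordinates below \<open>m\<close>.\<close>
  have "\<forall>m\<in>W []. \<exists>p. p \<in> P (map b [0..<m]) \<and> m \<in> G x p - {..<N}"
  proof
    fix m assume "m \<in> W []"
    then have "m \<in> W (map b [0..<m])" using inv by simp
    then show "\<exists>p. p \<in> P (map b [0..<m]) \<and> m \<in> G x p - {..<N}" unfolding W_def by blast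
  qed
  from bchoice[OF this] obtain p where p: "\<forall>m\<in>W []. p m \<in> P (map b [0..<m]) \<and> m \<in> G x (p m) - {..<N}"
    by (rule exE)
  obtain p' where p': "p' \<in> ?P" using cof unfolding dominating_def by blast
  \<comment> \<open>All \<open>p m\<close> lie below \<open>f\<close>: coordinates
    \<open>j < m\<close> are covered by \<open>b j\<close>, and for \<open>m \<le> j\<close> the
    value is in the finite sum.\<close>
  define f where "f j = b j + (\<Sum>m\<in>{..j} \<inter> W []. p m j)" for j
  have p_le: "p m j \<le> f j" if m: "m \<in> W []" for m j
  proof (cases "m \<le> j")
    case True
    have "p m j \<le> (\<Sum>m\<in>{..j} \<inter> W []. p m j)"
      using True m by (intro member_le_sum[where f = "\<lambda>m. p m j"]) auto
    then show ?thesis by (simp add: f_def)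
  next
    case False
    then have "p m j \<le> b j" using p m by (auto simp: P_def)
    then show ?thesis by (simp add: f_def)
  qed
  have full: "map p [0..<length s] = u"
    "\<exists>q\<in>R k N p. map q [0..<length s] = s \<and> (\<forall>j\<ge>length s. f j \<le> q j)" if "p \<in> ?P" for p f
    using that by (simp_all add: full_def)
  obtain r where r: "r \<in> R k N p'" "\<forall>j\<ge>length s. f j \<le> r j" using full(2)[OF p'] by blast
  have "W [] \<subseteq> G x r"
  proof
    fix m assume m: "m \<in> W []"
    have pm: "p m \<in> ?P" "m \<in> G x (p m)" "\<not> m < N" using p m by (auto simp: P_def)
    \<comment> \<open>Choosing \<open>q\<close> above \<open>p'\<close> beyond the stem, as
      \<open>r\<close> is above \<open>f\<close>, yields both inequalities required by the middle
      clause of \<open>K\<close>. On the stem they hold because \<open>p m\<close> agrees with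
      \<open>p'\<close> and \<open>q\<close> with \<open>r\<close>.\<close>
    obtain q where q: "q \<in> R k N (p m)" "\<forall>j\<ge>length s. p' j \<le> q j" using full(2)[OF pm(1)] by blast
    have eq: "p m j = p' j" if "j < length s" for j
      using full(1)[OF pm(1)] full(1)[OF p'] that by (metis add_0 diff_zero nth_map_upt)
    have 1: "p m j \<le> r j" for j
    proof (cases "j < length s")
      case True
      then show ?thesis using eq r(1) by (simp add: R_def le_fun_def)
    next
      case False
      then show ?thesis using p_le[OF m, of j] r(2) by (meson not_less order_trans)
    qed
    have 2: "p' j \<le> q j" for j
    proof (cases "j < length s")
      case True
      then show ?thesis using eq[symmetric] q(1) by (simp add: R_def le_fun_def)
    qed (use q(2) in simp)
    have "m \<in> G x q" using q(1) pm(2,3) by (auto simp: R_def)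
    then have "m \<in> lo (x, p m, q)" using pm(2) by (simp add: lo_def)
    moreover have "(x, p m, q) \<in> H k" "(x, p m, q) \<notin> Bad k m" using q(1) by (simp_all add: R_def)
    \<comment> \<open>\<open>K\<close> never joins triples over the same real. As
      \<open>(x, p m, q)\<close> is not bad, \<open>d\<close> replaces it over another real, with
      \<open>m\<close> still in \<open>lo d\<close> and the same functions along the common
      stem.\<close>
    ultimately obtain d where d: "d \<in> H k" "fst d \<noteq> x" "m \<in> lo d" and
      agree: "\<forall>n. map (fst d) [0..<n] = map x [0..<n] \<longrightarrow> fst (snd d) n = p m n \<and> snd (snd d) n = q n"
      unfolding Bad_def mem_Collect_eq fst_conv snd_conv by blast
    have "\<not> K d (x, p', r)" using noK d(1) r(1) by (simp add: R_def)
    moreover have "\<forall>n. map (fst d) [0..<n] = map x [0..<n] \<longrightarrow>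
        fst (snd d) n \<le> r n \<and> p' n \<le> snd (snd d) n"
      using agree 1 2 by simp
    ultimately have "lo d \<inter> A x \<subseteq> G x r" using d(2) unfolding K_def case_prod_beta by simp
    moreover have "m \<in> A x" using pm(2) G_subset_A by blast
    ultimately show "m \<in> G x r" using d(3) by blast
  qed
  moreover have "finite (A x - W [])" using W_cofinite cof P_Nil by simp
  ultimately have "finite (A x - G x r)" by (meson Diff_mono finite_subset order_refl)
  then show False using infinite_A_Diff_G by blast
qed

end

section \<open>From a ring isomorphism to a level embedding\<close>

text \<open>The block of \<open>Left\<close> marks the level. At least one \<open>Right\<close>
  follows, so different levels branch apart, while nodes of one level form a chain, injectively
  indexed by the code.\<close>

definition chain_node :: "bool list \<times> nat \<Rightarrow> node" where
  "chain_node = (\<lambda>(s, j). replicate (length s) Left @ replicate (Suc (to_nat (s, j))) Right)"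

lemma inj_chain_node: "inj chain_node"
proof (rule injI, clarify)
  fix s s' :: "bool list" and j j'
  assume eq: "chain_node (s, j) = chain_node (s', j')"
  then have "filter ((=) Right) (chain_node (s, j)) = filter ((=) Right) (chain_node (s', j'))" by simp
  then have "to_nat (s, j) = to_nat (s', j')"
    by (simp add: chain_node_def filter_replicate replicate_eq_replicate)
  then show "s = s' \<and> j = j'" by simp
qed

lemma chain_node_not_prefix:
  assumes "length s \<noteq> length s'"
  shows "\<not> prefix (chain_node (s, j)) (chain_node (s', j'))"
proof
  let ?v = "chain_node (s, j)" and ?v' = "chain_node (s', j')"
  assume "prefix ?v ?v'"
  then obtain zs where zs: "?v' = ?v @ zs" by (auto simp: prefix_def)
  have "?v' ! i = ?v ! i" if "i < length ?v" for i
    unfolding zs using that by (simp add: nth_append)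
  \<comment> \<open>At this position the node of the lower level has \<open>Right\<close> and the
    other still has \<open>Left\<close>.\<close>
  moreover define i where "i = min (length s) (length s')"
  moreover have "i < length ?v" by (simp add: i_def chain_node_def)
  moreover have "?v ! i = (if length s < length s' then Right else Left)"
    using assms by (auto simp: i_def chain_node_def nth_append min_def)
  moreover have "?v' ! i = (if length s < length s' then Left else Right)"
    using assms by (auto simp: i_def chain_node_def nth_append min_def)
  ultimately show False by (auto split: if_splits)
qed

lemma chain_node_parallel_iff:
  "parallel (chain_node (s, j)) (chain_node (s', j')) \<longleftrightarrow> length s \<noteq> length s'"
proof
  assume "length s \<noteq> length s'"
  then show "parallel (chain_node (s, j)) (chain_node (s', j'))"
    using chain_node_not_prefix[of s s'] chain_node_not_prefix[of s' s] by (intro parallelI) auto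
next
  assume par: "parallel (chain_node (s, j)) (chain_node (s', j'))"
  show "length s \<noteq> length s'"
  proof
    assume eq: "length s = length s'"
    have le: "prefix (replicate a Right) (replicate b Right)" if "a \<le> b" for a b
      using that by (metis le_add_diff_inverse prefixI replicate_add)
    have "prefix (chain_node (s, j)) (chain_node (s', j')) \<or> prefix (chain_node (s', j')) (chain_node (s, j))"
      unfolding chain_node_def prod.case eq same_prefix_prefix
      using le by (meson nat_le_linear)
    then show False using par by auto
  qed
qed

text \<open>An antichain has at most one node per level, and one node from each occupied level gives
  an antichain.\<close>

lemma big_chain_node_iff: "big parallel (chain_node ` C) \<longleftrightarrow> \<not> few_levels C"
  unfolding has_inf_antichain_iff_big[symmetric]
proof
  assume "has_inf_antichain (chain_node ` C)"
  then obtain T where T: "T \<subseteq> chain_node ` C" "infinite T" "pairwise parallel T"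
    by (auto simp: has_inf_antichain_def)
  then obtain S where S: "S \<subseteq> C" "T = chain_node ` S" by (metis subset_imageE)
  have "inj_on (\<lambda>(s, j). length s) S"
  proof (rule inj_onI, clarify)
    fix s j s' j' assume s: "(s, j) \<in> S" "(s', j') \<in> S" "length s = length s'"
    show "s = s' \<and> j = j'"
    proof (rule ccontr)
      assume "\<not> (s = s' \<and> j = j')"
      then have "chain_node (s, j) \<noteq> chain_node (s', j')"
        using inj_chain_node by (auto dest: injD)
      then have "parallel (chain_node (s, j)) (chain_node (s', j'))"
        using T(3) s(1,2) unfolding S(2) pairwise_def by blast
      then show False using s(3) by (simp add: chain_node_parallel_iff)
    qed
  qed
  moreover have "infinite S" using T(2) S(2) by auto
  ultimately have "infinite ((\<lambda>(s, j). length s) ` S)" by (simp add: finite_image_iff)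
  then show "\<not> few_levels C"
    unfolding few_levels_def using S(1) by (meson finite_subset image_mono)
next
  assume "\<not> few_levels C"
  then have inf: "infinite ((\<lambda>(s, j). length s) ` C)" by (simp add: few_levels_def)
  obtain S where S: "S \<subseteq> C" "inj_on (\<lambda>(s, j). length s) S"
    "(\<lambda>(s, j). length s) ` S = (\<lambda>(s, j). length s) ` C"
    using subset_image_inj[of "(\<lambda>(s, j). length s) ` C" "\<lambda>(s, j). length s" C] by auto
  have "infinite S" using inf S(3) by (metis finite_imageI)
  then have "infinite (chain_node ` S)"
    using inj_chain_node by (meson finite_imageD inj_on_subset subset_UNIV)
  moreover have "pairwise parallel (chain_node ` S)"
    unfolding pairwise_def
  proof (intro ballI impI)
    fix v v' assume "v \<in> chain_node ` S" "v' \<in> chain_node ` S" "v \<noteq> v'"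
    then obtain s j s' j' where v: "v = chain_node (s, j)" "(s, j) \<in> S"
      "v' = chain_node (s', j')" "(s', j') \<in> S" by auto
    then have "length s \<noteq> length s'" using inj_onD[OF S(2), of "(s, j)" "(s', j')"] \<open>v \<noteq> v'\<close> by auto
    then show "parallel v v'" using v by (simp add: chain_node_parallel_iff)
  qed
  ultimately show "has_inf_antichain (chain_node ` C)"
    unfolding has_inf_antichain_def using S(1) by blast
qed

lemma abs_pnat_fin_eq_0_iff: "abs_pnat_fin A = 0 \<longleftrightarrow> finite A"
  by (simp add: zero_pnat_fin_def pnat_fin.abs_eq_iff eq_mod_fin_def)

lemma abs_ptree_ac_eq_0_iff: "abs_ptree_ac A = 0 \<longleftrightarrow> \<not> big parallel A"
  by (simp add: zero_ptree_ac_def abs_ptree_ac_eq_iff)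

lemma abs_pnat_fin_Diff: "abs_pnat_fin (A - B) = abs_pnat_fin A + abs_pnat_fin A * abs_pnat_fin B"
proof -
  have "A - B = sym_diff A (A \<inter> B)" by blast
  then show ?thesis by (simp only: plus_pnat_fin.abs_eq times_pnat_fin.abs_eq)
qed

lemma abs_ptree_ac_Diff: "abs_ptree_ac (A - B) = abs_ptree_ac A + abs_ptree_ac A * abs_ptree_ac B"
proof -
  have "A - B = sym_diff A (A \<inter> B)" by blast
  then show ?thesis by (simp only: plus_ptree_ac.abs_eq times_ptree_ac.abs_eq)
qed

lemma ring_bijection_imp_not_OCA:
  fixes F :: "pnat_fin \<Rightarrow> ptree_ac"
  assumes bij: "bij F" and add: "\<And>x y. F (x + y) = F x + F y" and mult: "\<And>x y. F (x * y) = F x * F y"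
  shows "\<not> OCA"
proof -
  define t where "t C = abs_ptree_ac (chain_node ` C)" for C
  define g where "g = inv_into UNIV F"
  have Fg: "F (g y) = y" and gF: "g (F x) = x" for x y
    using bij by (simp_all add: g_def bij_is_surj surj_f_inv_f bij_is_inj)
  have g_mult: "g (x * y) = g x * g y" for x y
    using gF[of "g x * g y"] by (simp add: mult Fg)
  have g_add: "g (x + y) = g x + g y" for x y
    using gF[of "g x + g y"] by (simp add: add Fg)
  have g_eq: "g x = g y \<longleftrightarrow> x = y" for x y using Fg by metis
  have g_0: "g 0 = 0" using g_add[of 0 0] by simp
  \<comment> \<open>\<open>\<Psi>\<close> picks representatives for the inverse isomorphism
    restricted to sets of chain nodes.\<close>
  define \<Psi> where "\<Psi> C = rep_pnat_fin (g (t C))" for C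
  have abs: "abs_pnat_fin (\<Psi> C) = g (t C)" for C
    unfolding \<Psi>_def by (rule Quotient_abs_rep[OF Quotient_pnat_fin])
  have t_Int: "t (C \<inter> D) = t C * t D" for C D
    unfolding t_def by (simp add: times_ptree_ac.abs_eq image_Int[OF inj_chain_node])
  have "level_embedding \<Psi>"
  proof
    fix C D
    have "finite (\<Psi> C - \<Psi> D) \<longleftrightarrow> g (t C + t C * t D) = g 0"
      unfolding abs_pnat_fin_eq_0_iff[symmetric] abs_pnat_fin_Diff abs by (simp add: g_add g_mult g_0)
    also have "\<dots> \<longleftrightarrow> abs_ptree_ac (chain_node ` C - chain_node ` D) = 0"
      unfolding abs_ptree_ac_Diff g_eq t_def ..
    also have "\<dots> \<longleftrightarrow> few_levels (C - D)"
      by (simp add: abs_ptree_ac_eq_0_iff image_set_diff[OF inj_chain_node, symmetric] big_chain_node_iff)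
    finally show "finite (\<Psi> C - \<Psi> D) \<longleftrightarrow> few_levels (C - D)" .
    have "abs_pnat_fin (\<Psi> C \<inter> \<Psi> D) = abs_pnat_fin (\<Psi> (C \<inter> D))"
      unfolding times_pnat_fin.abs_eq[symmetric] abs by (simp add: t_Int g_mult)
    then show "finite (\<Psi> C \<inter> \<Psi> D - \<Psi> (C \<inter> D))"
      by (simp add: pnat_fin.abs_eq_iff eq_mod_fin_def)
  next
    fix B C assume B: "B \<subseteq> \<Psi> C"
    obtain E where E: "F (abs_pnat_fin B) = abs_ptree_ac E" using ex_ptree_ac by blast
    have "abs_pnat_fin B = abs_pnat_fin (B \<inter> \<Psi> C)" using B by (simp add: Int_absorb2)
    also have "\<dots> = abs_pnat_fin B * g (t C)" by (simp only: times_pnat_fin.abs_eq[symmetric] abs)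
    finally have "F (abs_pnat_fin B) = F (abs_pnat_fin B) * t C" using mult Fg by metis
    also have "\<dots> = abs_ptree_ac (E \<inter> chain_node ` C)" by (simp add: E t_def times_ptree_ac.abs_eq)
    \<comment> \<open>Everything below \<open>t C\<close> is again given by a set of chain nodes,
      which provides \<open>onto\<close>.\<close>
    also have "E \<inter> chain_node ` C = chain_node ` (chain_node -` E \<inter> C)" by blast
    finally have "abs_pnat_fin B = abs_pnat_fin (\<Psi> (chain_node -` E \<inter> C))"
      unfolding abs t_def using gF by metis
    then have "finite (sym_diff (\<Psi> (chain_node -` E \<inter> C)) B)"
      by (simp add: pnat_fin.abs_eq_iff eq_mod_fin_def)
    then show "\<exists>C'. finite (sym_diff (\<Psi> C') B)" by (rule exI)
  qed
  then show ?thesis by (rule level_embedding.not_OCA)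
qed

theorem theorem6p4:
  fixes n :: nat
  assumes "n \<ge> 2"
  shows "(CH \<longrightarrow> ring_mat TYPE(pnat_fin) n () \<simeq> ring_mat TYPE(ptree_ac) n ()) \<and>
         (OCA \<longrightarrow> \<not> ring_mat TYPE(pnat_fin) n () \<simeq> ring_mat TYPE(ptree_ac) n ())"
proof (intro conjI impI)
  assume CH
  then show "ring_mat TYPE(pnat_fin) n () \<simeq> ring_mat TYPE(ptree_ac) n ()"
  proof (rule CH_imp_ring_bijection)
    fix F :: "pnat_fin \<Rightarrow> ptree_ac"
    assume "bij F" "F 1 = 1" "\<And>x y. F (x + y) = F x + F y" "\<And>x y. F (x * y) = F x * F y"
    then show ?thesis by (rule ring_mat_iso_of_bijection)
  qed
next
  assume OCA: OCA
  show "\<not> ring_mat TYPE(pnat_fin) n () \<simeq> ring_mat TYPE(ptree_ac) n ()"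
  proof
    assume iso: "ring_mat TYPE(pnat_fin) n () \<simeq> ring_mat TYPE(ptree_ac) n ()"
    have "0 < n" using assms by simp
    then show False
      using iso
    proof (rule bijection_of_ring_mat_iso)
      fix F :: "pnat_fin \<Rightarrow> ptree_ac"
      assume "bij F" "\<And>x y. F (x + y) = F x + F y" "\<And>x y. F (x * y) = F x * F y"
      then have "\<not> OCA" by (rule ring_bijection_imp_not_OCA)
      with OCA show False by contradiction
    qed
  qed
qed

end
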